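(* Let $N\ge2$ be an integer, $\mu>0$, and consider the continuous-time $(\mu,(c_j),N)$-random walk on $\Omega_N$ with Green operator $G$. Let $\zeta>0$. (1) The following are equivalent: (i) $G^{\zeta}<\infty$; (ii) $\displaystyle\sum_{j=1}^\infty\frac1{N^jh_j^{\zeta}}<\infty$; (iii) $\displaystyle\sum_{j=0}^\infty\frac1{N^{j(\mu-\zeta)/\mu}\,d_j^{\zeta}}<\infty$. (2) If $$\limsup_{j\to\infty}\frac1{r_j}\sum_{i=j+1}^\infty r_i<\infty\qquad\Big(\text{equivalently}\quad\limsup_{j\to\infty}\frac1{c_j}\sum_{i=j+1}^\infty\frac{c_i}{N^{(i-j)/\mu}}<\infty\Big),\qquad( * )$$ then $$G^{\zeta}<\infty\quad\text{if and only if}\quad\sum_{j=0}^\infty\frac1{N^{j(\mu-\zeta)/\mu}\,c_j^{\zeta}}<\infty .$$ A sufficient condition for $( * )$ is $\limsup_{j\to\infty}c_{j+1}/c_j<N^{1/\mu}$; hence, for all sufficiently large $N$, it suffices that $\limsup_{j\to\infty}c_{j+1}/c_j<\infty$.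
   Context: $\Omega_N=\{x=(x_1,x_2,\dots): x_i\in\mathbb Z_N,\ x_i\ne0 \text{ for only finitely many } i\}$ with $\mathbb Z_N$ the cyclic group of order $N$ and componentwise addition mod $N$; $|x|=\max\{i:x_i\ne0\}$ for $x\neq 0$ and $|0|=0$; the hierarchical distance is $|x-y|$. Given a probability distribution $(r_j)_{j\ge1}$ on $\{1,2,\dots\}$ with all $r_j>0$, the $r_j$-random walk on $\Omega_N$ has i.i.d. steps $\eta$ with $\mathbb P[\eta=y]=\frac{r_{|y|}}{N^{|y|-1}(N-1)}$ for $y\neq0$ and $\mathbb P[\eta=0]=0$; its continuous-time version has unit-rate exponential holding times and transition probability $p_t(x,y)$. For a positive sequence $(c_j)_{j\ge0}$ with $\sum_j c_jN^{-j/\mu}<\infty$, the $(\mu,(c_j),N)$-random walk is the $r_j$-random walk with $r_j=D\,c_{j-1}N^{-(j-1)/\mu}$, $j\ge1$, where $D$ is the normalizing constant. Put $$h_j=\frac{N}{N-1}r_j+\sum_{i=j+1}^\infty r_i\quad(j\ge1),\qquad d_j=\frac N{N-1}c_j+\sum_{i=j+1}^\infty\frac{c_i}{N^{(i-j)/\mu}}\quad(j\ge0),$$ so that $h_j=D\,d_{j-1}N^{-(j-1)/\mu}$. $G^{\zeta}\varphi=\frac1{\Gamma(\zeta)}\int_0^\infty t^{\zeta-1}T_t\varphi\,dt$, $T_t$ the semigroup; "$G^\zeta<\infty$" means $G^\zeta\varphi<\infty$ for all finitely supported $\varphi\ge0$, equivalently (by irreducibility) $\int_0^\infty t^{\zeta-1}p_t(0,0)\,dt<\infty$.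 *)

theory Defs
  imports "HOL-Probability.Probability" "HOL-Algebra.Product_Groups"
begin

(* The restricted direct sum of copies of Z_N over the coordinates 1, 2, ...; elements are
   functions that are undefined at coordinate 0, so only coordinates i >= 1 may be inspected. *)
definition hgroup :: "nat \<Rightarrow> (nat \<Rightarrow> int) monoid" where
  "hgroup N = sum_group {1..} (\<lambda>_. integer_mod_group N)"

definition hnorm :: "nat \<Rightarrow> (nat \<Rightarrow> int) \<Rightarrow> nat" where
  "hnorm N x = (if x = \<one>\<^bsub>hgroup N\<^esub> then 0 else Max {i. 1 \<le> i \<and> x i \<noteq> 0})"

definition step_prob :: "nat \<Rightarrow> (nat \<Rightarrow> real) \<Rightarrow> (nat \<Rightarrow> int) \<Rightarrow> real" where
  "step_prob N r y =
     (if y = \<one>\<^bsub>hgroup N\<^esub> then 0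
      else r (hnorm N y) / (real N ^ (hnorm N y - 1) * (real N - 1)))"

definition step_law :: "nat \<Rightarrow> (nat \<Rightarrow> real) \<Rightarrow> (nat \<Rightarrow> int) measure" where
  "step_law N r = point_measure (carrier (hgroup N)) (\<lambda>y. ennreal (step_prob N r y))"

definition holding_law :: "real measure" where
  "holding_law = density lborel (\<lambda>s. ennreal (exponential_density 1 s))"

(* A sample point is a pair: i.i.d. steps, and independently i.i.d. unit-rate holding times. *)
definition walk_space ::
    "nat \<Rightarrow> (nat \<Rightarrow> real) \<Rightarrow> ((nat \<Rightarrow> nat \<Rightarrow> int) \<times> (nat \<Rightarrow> real)) measure" where
  "walk_space N r =
     (\<Pi>\<^sub>M n\<in>UNIV. step_law N r) \<Otimes>\<^sub>M (\<Pi>\<^sub>M n\<in>UNIV. holding_law)"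

primrec discrete_walk ::
    "nat \<Rightarrow> (nat \<Rightarrow> int) \<Rightarrow> (nat \<Rightarrow> nat \<Rightarrow> int) \<Rightarrow> nat \<Rightarrow> (nat \<Rightarrow> int)" where
  "discrete_walk N x \<eta> 0 = x"
| "discrete_walk N x \<eta> (Suc n) = discrete_walk N x \<eta> n \<otimes>\<^bsub>hgroup N\<^esub> \<eta> n"

(* The number of jumps up to time t; the set is infinite only on a null event. *)
definition jump_count :: "(nat \<Rightarrow> real) \<Rightarrow> real \<Rightarrow> nat" where
  "jump_count \<tau> t = card {n. (\<Sum>k\<le>n. \<tau> k) \<le> t}"

definition walk_at ::
    "nat \<Rightarrow> (nat \<Rightarrow> int) \<Rightarrow> real \<Rightarrow> (nat \<Rightarrow> nat \<Rightarrow> int) \<times> (nat \<Rightarrow> real) \<Rightarrow> (nat \<Rightarrow> int)" where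
  "walk_at N x t \<omega> = discrete_walk N x (fst \<omega>) (jump_count (snd \<omega>) t)"

definition trans_prob ::
    "nat \<Rightarrow> (nat \<Rightarrow> real) \<Rightarrow> real \<Rightarrow> (nat \<Rightarrow> int) \<Rightarrow> (nat \<Rightarrow> int) \<Rightarrow> real" where
  "trans_prob N r t x y =
     measure (walk_space N r) {\<omega> \<in> space (walk_space N r). walk_at N x t \<omega> = y}"

definition semigroup_op ::
    "nat \<Rightarrow> (nat \<Rightarrow> real) \<Rightarrow> real \<Rightarrow> ((nat \<Rightarrow> int) \<Rightarrow> real) \<Rightarrow> (nat \<Rightarrow> int) \<Rightarrow> real" where
  "semigroup_op N r t \<phi> x = (\<Sum>\<^sub>\<infinity>y\<in>carrier (hgroup N). trans_prob N r t x y * \<phi> y)"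

(* Only meaningful for nonnegative functions: ennreal truncates negative reals to 0. *)
definition green_power ::
    "nat \<Rightarrow> (nat \<Rightarrow> real) \<Rightarrow> real \<Rightarrow> ((nat \<Rightarrow> int) \<Rightarrow> real) \<Rightarrow> (nat \<Rightarrow> int) \<Rightarrow> ennreal" where
  "green_power N r \<zeta> \<phi> x =
     ennreal (1 / Gamma \<zeta>) *
     (\<integral>\<^sup>+t\<in>{0<..}. ennreal (t powr (\<zeta> - 1) * semigroup_op N r t \<phi> x) \<partial>lborel)"

definition green_power_finite :: "nat \<Rightarrow> (nat \<Rightarrow> real) \<Rightarrow> real \<Rightarrow> bool" where
  "green_power_finite N r \<zeta> \<longleftrightarrow>
     (\<forall>\<phi>. (\<forall>x\<in>carrier (hgroup N). 0 \<le> \<phi> x) \<and> finite {x \<in> carrier (hgroup N). \<phi> x \<noteq> 0} \<longrightarrow>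
          (\<forall>x\<in>carrier (hgroup N). green_power N r \<zeta> \<phi> x < \<infinity>))"

definition mu_weights_summable :: "nat \<Rightarrow> real \<Rightarrow> (nat \<Rightarrow> real) \<Rightarrow> bool" where
  "mu_weights_summable N \<mu> c \<longleftrightarrow> (\<lambda>j. c j * real N powr (- real j / \<mu>)) summable_on UNIV"

(* Only the values at j >= 1 are used. *)
definition mu_rates :: "nat \<Rightarrow> real \<Rightarrow> (nat \<Rightarrow> real) \<Rightarrow> nat \<Rightarrow> real" where
  "mu_rates N \<mu> c j =
     1 / (\<Sum>\<^sub>\<infinity>i. c i * real N powr (- real i / \<mu>)) *
     (c (j - 1) * real N powr (- real (j - 1) / \<mu>))"

definition h_seq :: "nat \<Rightarrow> (nat \<Rightarrow> real) \<Rightarrow> nat \<Rightarrow> real" where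
  "h_seq N r j = real N / (real N - 1) * r j + (\<Sum>\<^sub>\<infinity>i\<in>{j+1..}. r i)"

definition c_tail :: "nat \<Rightarrow> real \<Rightarrow> (nat \<Rightarrow> real) \<Rightarrow> nat \<Rightarrow> real" where
  "c_tail N \<mu> c j = (\<Sum>\<^sub>\<infinity>i\<in>{j+1..}. c i / real N powr (real (i - j) / \<mu>))"

definition d_seq :: "nat \<Rightarrow> real \<Rightarrow> (nat \<Rightarrow> real) \<Rightarrow> nat \<Rightarrow> real" where
  "d_seq N \<mu> c j = real N / (real N - 1) * c j + c_tail N \<mu> c j"

definition r_tail_condition :: "(nat \<Rightarrow> real) \<Rightarrow> bool" where
  "r_tail_condition r \<longleftrightarrow> limsup (\<lambda>j. ereal (1 / r j * (\<Sum>\<^sub>\<infinity>i\<in>{j+1..}. r i))) < \<infinity>"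

definition c_tail_condition :: "nat \<Rightarrow> real \<Rightarrow> (nat \<Rightarrow> real) \<Rightarrow> bool" where
  "c_tail_condition N \<mu> c \<longleftrightarrow> limsup (\<lambda>j. ereal (1 / c j * c_tail N \<mu> c j)) < \<infinity>"

end

theory Submission
  imports Defs
begin

text \<open>The balls \<open>B\<^sub>k = {x. |x| \<le> k}\<close> form an increasing chain of subgroups of order \<open>N ^ k\<close>. The step law
  is a combination of the uniform laws on the balls, and convolution with the uniform law on \<open>B\<^sub>k\<close>
  is a projection, so the step operator is diagonalised by the kernels
  \<open>E\<^sub>k = 1\<^bsub>B\<^sub>k\<^esub> / N ^ k - 1\<^bsub>B\<^sub>k\<^sub>+\<^sub>1\<^esub> / N ^ (k + 1)\<close>, with eigenvalues \<open>1 - h\<^sub>k\<^sub>+\<^sub>1\<close>; moreover the \<open>E\<^sub>k\<close> sum to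
  the unit mass at the identity. Randomising the number of steps by a Poisson clock yields
  \<open>p\<^sub>t(x, y) = (\<Sum>k. exp (- t h\<^sub>k\<^sub>+\<^sub>1) E\<^sub>k(x - y))\<close>, which is largest on the diagonal. Integrating
  against \<open>t powr (\<zeta> - 1)\<close> turns finiteness of \<open>G\<^sup>\<zeta>\<close> into convergence of
  \<open>\<Sum>k. N ^ -k h\<^sub>k powr -\<zeta>\<close>. The rest compares series, using \<open>h\<^sub>j\<^sub>+\<^sub>1 = D N powr (- j / \<mu>) d\<^sub>j\<close>.\<close>

subsection \<open>Poisson counting of the jumps\<close>

abbreviation holding_times :: "(nat \<Rightarrow> real) measure" where
  "holding_times \<equiv> \<Pi>\<^sub>M n\<in>UNIV. holding_law"

lemma sets_holding_law [measurable_cong]: "sets holding_law = sets borel"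
  by (simp add: holding_law_def)

interpretation holding_law: prob_space holding_law
  unfolding holding_law_def by (rule prob_space_exponential_density) simp

interpretation holding_times: sequence_space holding_law
  by unfold_locales

lemma distr_holding_times: "distr holding_times borel (\<lambda>\<tau>. \<tau> i) = holding_law"
  using distr_PiM_component[of UNIV "\<lambda>_. holding_law" i]
  by (simp add: holding_law.prob_space_axioms sets_holding_law cong: distr_cong)

lemma distributed_holding_time:
  "distributed holding_times lborel (\<lambda>\<tau>. \<tau> i) (exponential_density 1)"
proof -
  have "distr holding_times lborel (\<lambda>\<tau>. \<tau> i) = distr holding_times borel (\<lambda>\<tau>. \<tau> i)"
    by (intro distr_cong) auto
  then show ?thesis
    unfolding distributed_def by (simp add: distr_holding_times) (simp add: holding_law_def)
qed

text \<open>The coordinates together form the identity map, whose law is the product measure itself,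
  and every marginal is \<open>holding_law\<close>; so the joint law is the product of the
  marginals.\<close>

lemma indep_holding_times:
  "holding_times.indep_vars (\<lambda>_. borel) (\<lambda>i \<tau>. \<tau> i) A"
proof -
  have "holding_times.indep_vars (\<lambda>_. borel) (\<lambda>i \<tau>. \<tau> i) UNIV"
  proof (subst holding_times.indep_vars_iff_distr_eq_PiM')
    have "sets (\<Pi>\<^sub>M i\<in>UNIV. borel) = sets holding_times"
      by (intro sets_PiM_cong) (auto simp: sets_holding_law)
    then have "distr holding_times (\<Pi>\<^sub>M i\<in>UNIV. borel) (\<lambda>x. x) = holding_times"
      by (rule distr_id2)
    then show "distr holding_times (\<Pi>\<^sub>M i\<in>UNIV. borel) (\<lambda>x. \<lambda>i\<in>UNIV. x i)
        = (\<Pi>\<^sub>M i\<in>UNIV. distr holding_times borel (\<lambda>\<tau>. \<tau> i))"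
      by (simp add: distr_holding_times restrict_def)
  qed auto
  then show ?thesis
    by (rule holding_times.indep_vars_subset) simp
qed

text \<open>The jump numbered \<open>n\<close>, counting from 0, occurs at the sum of
  \<open>n + 1\<close> independent unit exponentials; the Erlang index is one less than the number
  of summands.\<close>

lemma prob_jump_time_le:
  assumes "t \<ge> 0"
  shows "\<P>(\<tau> in holding_times. (\<Sum>k\<le>n. \<tau> k) \<le> t) = erlang_CDF n 1 t"
proof (rule holding_times.erlang_distributed_le)
  show "distributed holding_times lborel (\<lambda>\<tau>. \<Sum>k\<le>n. \<tau> k) (erlang_density n 1)"
    using holding_times.exponential_distributed_sum[of "{..n}" 1 "\<lambda>i \<tau>. \<tau> i"]
      distributed_holding_time indep_holding_times by simp
qed (use assms in auto)

text \<open>For \<open>t \<ge> 0\<close> this is the tail of a Poisson law: one minus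
  \<open>exp (- t)\<close> times a partial sum of the exponential series. It serves to rule out
  infinitely many jumps by time \<open>t\<close>.\<close>

lemma erlang_CDF_tendsto_0: "(\<lambda>n. erlang_CDF n 1 t) \<longlonglongrightarrow> 0"
proof (cases "t < 0")
  case False
  have "(\<lambda>n. \<Sum>m\<le>n. t ^ m /\<^sub>R fact m) \<longlonglongrightarrow> exp t"
    using exp_converges[of t] by (simp add: sums_def_le)
  then have "(\<lambda>n. 1 - exp (- t) * (\<Sum>m\<le>n. t ^ m /\<^sub>R fact m)) \<longlonglongrightarrow> 1 - exp (- t) * exp t"
    by (intro tendsto_intros)
  moreover have "1 - exp (- t) * (\<Sum>m\<le>n. t ^ m /\<^sub>R fact m) = erlang_CDF n 1 t" for n
    using False by (simp add: erlang_CDF_def sum_distrib_left field_simps)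
  ultimately show ?thesis
    by (simp flip: exp_add)
qed (simp add: erlang_CDF_def)

section \<open>The Poisson law of the number of jumps\<close>

lemma AE_holding_times_nonneg: "AE \<tau> in holding_times. \<forall>k. \<tau> k \<ge> 0"
proof -
  have "AE s in holding_law. s \<ge> 0"
    unfolding holding_law_def by (subst AE_density) (auto simp: exponential_density_def)
  then have "AE \<tau> in holding_times. \<tau> k \<ge> 0" for k
    by (intro AE_PiM_component) (auto simp: holding_law.prob_space_axioms)
  then show ?thesis
    by (simp add: AE_all_countable)
qed

text \<open>Since \<open>card\<close> of an infinite set is 0, \<open>jump_count\<close> counts
  correctly only if finitely many jumps occur by time \<open>t\<close>. The probability of
  infinitely many is at most every \<open>erlang_CDF n 1 t\<close>, hence zero. Nonnegative holding
  times make the jump times monotone, so the counted set is an initial segment.\<close>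

lemma AE_less_jump_count:
  assumes "t \<ge> 0"
  shows "AE \<tau> in holding_times. \<forall>n. n < jump_count \<tau> t \<longleftrightarrow> (\<Sum>k\<le>n. \<tau> k) \<le> t"
proof -
  let ?A = "{\<tau> \<in> space holding_times. \<forall>n. (\<Sum>k\<le>n. \<tau> k) \<le> t}"
  have "measure holding_times ?A \<le> erlang_CDF n 1 t" for n
    unfolding prob_jump_time_le[OF assms, symmetric]
    by (intro holding_times.finite_measure_mono) auto
  then have "measure holding_times ?A \<le> 0"
    using LIMSEQ_le_const[OF erlang_CDF_tendsto_0] by blast
  then have "measure holding_times ?A = 0"
    using measure_nonneg by (rule antisym)
  moreover have "?A \<in> sets holding_times"
    by measurable
  ultimately have "AE \<tau> in holding_times. \<tau> \<notin> ?A"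
    using holding_times.prob_eq_0 by blast
  then have "AE \<tau> in holding_times. \<not> (\<forall>n. (\<Sum>k\<le>n. \<tau> k) \<le> t)"
    using AE_space by eventually_elim simp
  then show ?thesis
    using AE_holding_times_nonneg
  proof eventually_elim
    fix \<tau> :: "nat \<Rightarrow> real"
    assume ex: "\<not> (\<forall>n. (\<Sum>k\<le>n. \<tau> k) \<le> t)" and nonneg: "\<forall>k. \<tau> k \<ge> 0"
    \<comment> \<open>The first jump after time \<open>t\<close>; the counted jumps are exactly
      those numbered below \<open>m\<close>.\<close>
    define m where "m = (LEAST n. \<not> (\<Sum>k\<le>n. \<tau> k) \<le> t)"
    have mono: "(\<Sum>k\<le>i. \<tau> k) \<le> (\<Sum>k\<le>j. \<tau> k)" if "i \<le> j" for i j
      using that nonneg by (intro sum_mono2) auto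
    have m: "\<not> (\<Sum>k\<le>m. \<tau> k) \<le> t"
      using LeastI_ex[of "\<lambda>n. \<not> (\<Sum>k\<le>n. \<tau> k) \<le> t"] ex by (simp add: m_def)
    have iff: "(\<Sum>k\<le>n. \<tau> k) \<le> t \<longleftrightarrow> n < m" for n
    proof
      show "n < m" if "(\<Sum>k\<le>n. \<tau> k) \<le> t"
        using m mono[of m n] that by linarith
      show "(\<Sum>k\<le>n. \<tau> k) \<le> t" if "n < m"
        using not_less_Least[of n "\<lambda>n. \<not> (\<Sum>k\<le>n. \<tau> k) \<le> t"] that by (simp add: m_def)
    qed
    then have "jump_count \<tau> t = m"
      by (simp add: jump_count_def flip: lessThan_def)
    then show "\<forall>n. n < jump_count \<tau> t \<longleftrightarrow> (\<Sum>k\<le>n. \<tau> k) \<le> t"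
      using iff by simp
  qed
qed

lemma measurable_jump_count [measurable]:
  "(\<lambda>\<tau>. jump_count \<tau> t) \<in> measurable holding_times (count_space UNIV)"
  unfolding jump_count_def by measurable

lemma prob_less_jump_count:
  assumes "t \<ge> 0"
  shows "\<P>(\<tau> in holding_times. n < jump_count \<tau> t) = erlang_CDF n 1 t"
  unfolding prob_jump_time_le[OF assms, symmetric]
  by (rule holding_times.finite_measure_eq_AE)
     (use AE_less_jump_count[OF assms] in \<open>auto elim!: eventually_mono\<close>)

text \<open>Consecutive Erlang distribution functions differ by a single Poisson weight.\<close>

lemma prob_jump_count:
  assumes "t \<ge> 0"
  shows "\<P>(\<tau> in holding_times. jump_count \<tau> t = n) = t ^ n * exp (- t) / fact n"
proof (cases n)
  case 0
  have "\<P>(\<tau> in holding_times. \<not> 0 < jump_count \<tau> t) = 1 - \<P>(\<tau> in holding_times. 0 < jump_count \<tau> t)"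
    by (rule holding_times.prob_neg) simp
  then show ?thesis
    using 0 assms by (simp add: prob_less_jump_count erlang_CDF_def)
next
  case (Suc m)
  have "{\<tau> \<in> space holding_times. m < jump_count \<tau> t} - {\<tau> \<in> space holding_times. Suc m < jump_count \<tau> t}
      = {\<tau> \<in> space holding_times. jump_count \<tau> t = n}"
    using Suc by auto
  moreover have "measure holding_times ({\<tau> \<in> space holding_times. m < jump_count \<tau> t}
        - {\<tau> \<in> space holding_times. Suc m < jump_count \<tau> t})
      = erlang_CDF m 1 t - erlang_CDF (Suc m) 1 t"
    by (subst holding_times.finite_measure_Diff) (auto simp: prob_less_jump_count assms)
  ultimately show ?thesis
    using Suc assms by (simp add: erlang_CDF_def)
qed

text \<open>The probability generating function of the Poisson law. An eigenfunction of the step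
  operator gains a factor \<open>l ^ n\<close> in \<open>n\<close> steps, and averaging over the
  clock turns it into decay at rate \<open>1 - l\<close>.\<close>

lemma expectation_power_jump_count:
  assumes "t \<ge> 0"
  shows "(\<integral>\<tau>. l ^ jump_count \<tau> t \<partial>holding_times) = exp (- t * (1 - l))"
proof -
  let ?A = "\<lambda>n. {\<tau> \<in> space holding_times. jump_count \<tau> t = n}"
  have exp_sums: "(\<lambda>n. a ^ n * (t ^ n * exp (- t) / fact n)) sums (exp (- t) * exp (t * a))" for a :: real
    using sums_mult[OF exp_converges[of "t * a"], of "exp (- t)"]
    by (simp add: field_simps power_mult_distrib)
  have int: "(\<integral>\<tau>. c * indicator (?A n) \<tau> \<partial>holding_times) = c * (t ^ n * exp (- t) / fact n)" for c n
    using prob_jump_count[OF assms, of n] by (simp add: Int_absorb2)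
  have sum_ind: "(\<lambda>n. a ^ n * indicator (?A n) \<tau>) sums a ^ jump_count \<tau> t"
    if "\<tau> \<in> space holding_times" for \<tau> and a :: real
  proof -
    have "(\<lambda>n. a ^ n * indicator (?A n) \<tau>) = (\<lambda>n. if n = jump_count \<tau> t then a ^ n else 0)"
      using that by (auto simp: indicator_def)
    then show ?thesis
      using sums_single[of "jump_count \<tau> t" "\<lambda>n. a ^ n"] by simp
  qed
  have "(\<integral>\<tau>. l ^ jump_count \<tau> t \<partial>holding_times) = (\<integral>\<tau>. (\<Sum>n. l ^ n * indicator (?A n) \<tau>) \<partial>holding_times)"
    using sum_ind[THEN sums_unique] by (intro Bochner_Integration.integral_cong refl) auto
  also have "\<dots> = (\<Sum>n. \<integral>\<tau>. l ^ n * indicator (?A n) \<tau> \<partial>holding_times)"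
  proof (rule integral_suminf)
    show "integrable holding_times (\<lambda>\<tau>. l ^ n * indicator (?A n) \<tau>)" for n
      by (intro integrable_mult_right integrable_real_indicator) (auto simp: less_top[symmetric])
    \<comment> \<open>The same series at \<open>\<bar>l\<bar>\<close> give absolute convergence,
      here pointwise and next for the integrals.\<close>
    show "AE \<tau> in holding_times. summable (\<lambda>n. norm (l ^ n * indicator (?A n) \<tau>))"
      using sum_ind[THEN sums_summable, of _ "\<bar>l\<bar>"] by (intro AE_I2) (simp add: abs_mult power_abs)
    show "summable (\<lambda>n. \<integral>\<tau>. norm (l ^ n * indicator (?A n) \<tau>) \<partial>holding_times)"
      using exp_sums[THEN sums_summable, of "\<bar>l\<bar>"]
      by (simp add: abs_mult power_abs prob_jump_count[OF assms])
  qed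
  also have "\<dots> = exp (- t) * exp (t * l)"
    unfolding int using exp_sums[of l] by (rule sums_unique[symmetric])
  also have "\<dots> = exp (- t * (1 - l))"
    by (simp add: algebra_simps flip: exp_add)
  finally show ?thesis .
qed

subsection \<open>Balls and kernels on the hierarchical group\<close>

locale hierarchical_group =
  fixes N :: nat
  assumes N_ge2: "N \<ge> 2"
begin

abbreviation G where "G \<equiv> hgroup N"

text \<open>Phrased by vanishing coordinates rather than by \<open>hnorm\<close>, so that the
  subgroup property can be checked coordinatewise; \<open>hnorm_hball_diff\<close> restores the link
  with the norm.\<close>

definition hball :: "nat \<Rightarrow> (nat \<Rightarrow> int) set" where
  "hball k = {x \<in> carrier G. \<forall>i>k. x i = 0}"

lemma comm_group_G: "comm_group G"
proof -
  have "group G"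
    unfolding hgroup_def by (rule sum_group) simp
  then show ?thesis
    by (rule group.group_comm_groupI) (auto simp: hgroup_def add.commute)
qed

sublocale comm_group G
  by (rule comm_group_G)

lemma carrier_G: "carrier G = {x \<in> {1..} \<rightarrow>\<^sub>E {0..<int N}. finite {i \<in> {1..}. x i \<noteq> 0}}"
  using N_ge2 by (simp add: hgroup_def carrier_sum_group carrier_integer_mod_group)

lemma one_G: "\<one>\<^bsub>G\<^esub> = (\<lambda>i\<in>{1..}. 0)"
  by (simp add: hgroup_def)

lemma mult_G: "x \<otimes>\<^bsub>G\<^esub> y = (\<lambda>i\<in>{1..}. (x i + y i) mod int N)"
  by (simp add: hgroup_def)

lemma inv_G: "x \<in> carrier G \<Longrightarrow> inv\<^bsub>G\<^esub> x = (\<lambda>i\<in>{1..}. (- x i) mod int N)"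
  unfolding hgroup_def
  by (subst inv_sum_group) (auto simp: carrier_sum_group PiE_iff intro!: restrict_ext)

lemma subgroup_hball: "subgroup (hball k) G"
proof
  show "x \<otimes>\<^bsub>G\<^esub> y \<in> hball k" if "x \<in> hball k" "y \<in> hball k" for x y
  proof -
    have "x \<otimes>\<^bsub>G\<^esub> y \<in> carrier G"
      using that by (auto simp: hball_def)
    moreover have "\<forall>i>k. (x \<otimes>\<^bsub>G\<^esub> y) i = 0"
      using that by (auto simp: hball_def mult_G)
    ultimately show ?thesis
      by (simp add: hball_def)
  qed
  show "inv\<^bsub>G\<^esub> x \<in> hball k" if "x \<in> hball k" for x
  proof -
    have "x \<in> carrier G"
      using that by (auto simp: hball_def)
    then have "inv\<^bsub>G\<^esub> x \<in> carrier G"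
      by simp
    moreover have "\<forall>i>k. (inv\<^bsub>G\<^esub> x) i = 0"
      using that \<open>x \<in> carrier G\<close> by (auto simp: hball_def inv_G)
    ultimately show ?thesis
      by (simp add: hball_def)
  qed
qed (use N_ge2 in \<open>auto simp: hball_def one_G carrier_G\<close>)

lemma hball_subset: "hball k \<subseteq> carrier G"
  by (auto simp: hball_def)

lemma hball_mono: "k \<le> l \<Longrightarrow> hball k \<subseteq> hball l"
  by (auto simp: hball_def)

lemma hball_0: "hball 0 = {\<one>\<^bsub>G\<^esub>}"
proof
  show "hball 0 \<subseteq> {\<one>\<^bsub>G\<^esub>}"
    by (auto simp: hball_def carrier_G one_G PiE_iff extensional_def fun_eq_iff)
  show "{\<one>\<^bsub>G\<^esub>} \<subseteq> hball 0"
    using subgroup.one_closed[OF subgroup_hball] by simp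
qed

lemma carrier_eq_Union_hball: "carrier G = (\<Union>k. hball k)"
proof
  show "carrier G \<subseteq> (\<Union>k. hball k)"
  proof
    fix x assume x: "x \<in> carrier G"
    then have "finite {i \<in> {1..}. x i \<noteq> 0}"
      by (simp add: carrier_G)
    then obtain k where "\<forall>i\<in>{i \<in> {1..}. x i \<noteq> 0}. i \<le> k"
      using finite_nat_set_iff_bounded_le by blast
    then have "x \<in> hball k"
      using x by (auto simp: hball_def) (metis One_nat_def Suc_leI Suc_le_eq gr0I less_le_not_le not_less_zero)
    then show "x \<in> (\<Union>k. hball k)"
      by blast
  qed
qed (use hball_subset in blast)

text \<open>For counting: an element of the ball is determined by its first \<open>k\<close>
  coordinates, and padding with zeros inverts the truncation.\<close>

lemma bij_betw_hball:
  "bij_betw (\<lambda>x. restrict x {1..k}) (hball k) ({1..k} \<rightarrow>\<^sub>E {0..<int N})"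
proof (rule bij_betw_byWitness[where f' = "\<lambda>x. \<lambda>i\<in>{1..}. if i \<le> k then x i else 0"])
  show "\<forall>x\<in>hball k. (\<lambda>i\<in>{1..}. if i \<le> k then restrict x {1..k} i else 0) = x"
    by (auto simp: hball_def carrier_G PiE_iff extensional_def fun_eq_iff)
  show "\<forall>x\<in>{1..k} \<rightarrow>\<^sub>E {0..<int N}.
          restrict (\<lambda>i\<in>{1..}. if i \<le> k then x i else 0) {1..k} = x"
    by (auto simp: PiE_iff extensional_def fun_eq_iff)
  show "(\<lambda>x. restrict x {1..k}) ` hball k \<subseteq> {1..k} \<rightarrow>\<^sub>E {0..<int N}"
    by (auto simp: hball_def carrier_G PiE_iff)
  show "(\<lambda>x. \<lambda>i\<in>{1..}. if i \<le> k then x i else 0) ` ({1..k} \<rightarrow>\<^sub>E {0..<int N}) \<subseteq> hball k"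
  proof (rule image_subsetI)
    fix x assume x: "x \<in> {1..k} \<rightarrow>\<^sub>E {0..<int N}"
    have "finite {i \<in> {1..}. (\<lambda>i\<in>{1..}. if i \<le> k then x i else 0) i \<noteq> 0}"
      by (rule finite_subset[of _ "{..k}"]) (auto split: if_splits)
    then show "(\<lambda>i\<in>{1..}. if i \<le> k then x i else 0) \<in> hball k"
      using x N_ge2 by (auto simp: hball_def carrier_G PiE_iff)
  qed
qed

lemma finite_hball: "finite (hball k)"
  using bij_betw_finite[OF bij_betw_hball, of k] by (simp add: finite_PiE)

lemma card_hball: "card (hball k) = N ^ k"
  using bij_betw_same_card[OF bij_betw_hball, of k] by (simp add: card_PiE)

lemma countable_carrier: "countable (carrier G)"
  unfolding carrier_eq_Union_hball using finite_hball by (blast intro: countable_finite)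

text \<open>Spheres are differences of consecutive balls: a nonzero coordinate beyond
  \<open>k\<close> can only sit at \<open>Suc k\<close>, which is then the largest one.\<close>

lemma hnorm_hball_diff:
  assumes "x \<in> hball (Suc k) - hball k"
  shows "hnorm N x = Suc k"
proof -
  have x: "x \<in> carrier G" "\<And>i. i > Suc k \<Longrightarrow> x i = 0" "x \<notin> hball k"
    using assms by (auto simp: hball_def)
  then obtain i where "i > k" "x i \<noteq> 0"
    by (auto simp: hball_def)
  then have nz: "x (Suc k) \<noteq> 0"
    using x(2) by (metis Suc_lessI)
  have "x \<noteq> \<one>\<^bsub>G\<^esub>"
    using x(3) subgroup.one_closed[OF subgroup_hball] by metis
  moreover have "Max {i. 1 \<le> i \<and> x i \<noteq> 0} = Suc k"
  proof (rule Max_eqI)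
    show "y \<le> Suc k" if "y \<in> {i. 1 \<le> i \<and> x i \<noteq> 0}" for y
      using that x(2) by (metis (mono_tags, lifting) mem_Collect_eq not_le)
    then show "finite {i. 1 \<le> i \<and> x i \<noteq> 0}"
      by (meson atMost_iff finite_atMost finite_subset subsetI)
  qed (use nz in simp)
  ultimately show ?thesis
    by (simp add: hnorm_def)
qed

lemma step_prob_hball_diff:
  assumes "x \<in> hball (Suc k) - hball k"
  shows "step_prob N r x = r (Suc k) / (real N ^ k * (real N - 1))"
proof -
  have "x \<noteq> \<one>\<^bsub>G\<^esub>"
    using assms subgroup.one_closed[OF subgroup_hball] by (metis DiffD2)
  then show ?thesis
    using hnorm_hball_diff[OF assms] by (simp add: step_prob_def)
qed

text \<open>The sphere of radius \<open>Suc k\<close> has \<open>N ^ k * (N - 1)\<close> points,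
  exactly the denominator in \<open>step_prob\<close>, so it carries mass
  \<open>r (Suc k)\<close>.\<close>

lemma sum_step_prob_hball: "(\<Sum>x\<in>hball k. step_prob N r x) = (\<Sum>j<k. r (Suc j))"
proof (induction k)
  case 0
  then show ?case
    by (simp add: hball_0 step_prob_def)
next
  case (Suc k)
  have "real N > 1"
    using N_ge2 by simp
  have "card (hball (Suc k) - hball k) = N ^ Suc k - N ^ k"
    by (simp add: card_Diff_subset finite_hball hball_mono card_hball)
  then have c: "real (card (hball (Suc k) - hball k)) = real N ^ k * (real N - 1)"
    using N_ge2 by (simp add: algebra_simps of_nat_diff)
  have "(\<Sum>x\<in>hball (Suc k). step_prob N r x)
      = (\<Sum>x\<in>hball (Suc k) - hball k. step_prob N r x) + (\<Sum>x\<in>hball k. step_prob N r x)"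
    by (rule sum.subset_diff) (simp_all add: hball_mono finite_hball)
  also have "(\<Sum>x\<in>hball (Suc k) - hball k. step_prob N r x)
      = (\<Sum>x\<in>hball (Suc k) - hball k. r (Suc k) / (real N ^ k * (real N - 1)))"
    by (intro sum.cong refl step_prob_hball_diff)
  also have "\<dots> = r (Suc k)"
    using \<open>real N > 1\<close> c by simp
  finally show ?case
    using Suc.IH by simp
qed

section \<open>Differences of the uniform densities on consecutive balls\<close>

definition hkernel :: "nat \<Rightarrow> (nat \<Rightarrow> int) \<Rightarrow> real" where
  "hkernel k z = indicator (hball k) z / real N ^ k - indicator (hball (Suc k)) z / real N ^ Suc k"

text \<open>The kernel equals \<open>(N - 1) / N ^ Suc k\<close> on \<open>hball k\<close>,
  \<open>- 1 / N ^ Suc k\<close> on the sphere around it and 0 elsewhere; the first value has the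
  largest modulus because \<open>N \<ge> 2\<close>. The bound is uniform in \<open>z\<close> and
  summable in \<open>k\<close>, which justifies the later exchanges of sum and integral.\<close>

lemma abs_hkernel_le: "\<bar>hkernel k z\<bar> \<le> hkernel k \<one>\<^bsub>G\<^esub>"
  and hkernel_one: "hkernel k \<one>\<^bsub>G\<^esub> = (real N - 1) / real N ^ Suc k"
proof -
  have "\<one>\<^bsub>G\<^esub> \<in> hball k" "\<one>\<^bsub>G\<^esub> \<in> hball (Suc k)"
    using subgroup.one_closed[OF subgroup_hball] by auto
  then show one: "hkernel k \<one>\<^bsub>G\<^esub> = (real N - 1) / real N ^ Suc k"
    using N_ge2 by (simp add: hkernel_def field_simps)
  have "\<bar>hkernel k z\<bar> \<le> (real N - 1) / real N ^ Suc k"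
    using N_ge2 hball_mono[of k "Suc k"]
    by (auto simp: hkernel_def indicator_def field_simps)
  then show "\<bar>hkernel k z\<bar> \<le> hkernel k \<one>\<^bsub>G\<^esub>"
    using one by simp
qed

lemma summable_hkernel_one: "summable (\<lambda>k. hkernel k \<one>\<^bsub>G\<^esub>)"
proof -
  have "summable (\<lambda>k. (real N - 1) * (1 / real N) ^ Suc k)"
    using N_ge2 by (intro summable_mult summable_Suc_iff[THEN iffD2] summable_geometric) auto
  then show ?thesis
    by (simp add: hkernel_one power_one_over field_simps)
qed

text \<open>The series telescopes: its first term comes from the trivial subgroup
  \<open>hball 0\<close>, and the density on \<open>hball k\<close> is at most
  \<open>1 / N ^ k\<close>.\<close>

lemma hkernel_sums: "(\<lambda>k. hkernel k z) sums indicator {\<one>\<^bsub>G\<^esub>} z"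
proof -
  have "(\<lambda>k. indicator (hball k) z / real N ^ k) \<longlonglongrightarrow> 0"
  proof (rule tendsto_sandwich[OF _ _ tendsto_const])
    show "(\<lambda>k. (1 / real N) ^ k) \<longlonglongrightarrow> 0"
      using N_ge2 by (intro LIMSEQ_realpow_zero) auto
  qed (use N_ge2 in \<open>auto simp: indicator_def power_one_over\<close>)
  from telescope_sums'[OF this] show ?thesis
    by (simp add: hkernel_def hball_0)
qed

end

subsection \<open>Spectral form of the transition probabilities\<close>

locale hierarchical_walk = hierarchical_group +
  fixes r :: "nat \<Rightarrow> real"
  assumes rate_pos: "\<And>j. r (Suc j) > 0"
    and rate_sums: "(\<lambda>j. r (Suc j)) sums 1"
begin

lemma rate_nonneg: "r (Suc j) \<ge> 0"
  using rate_pos by (rule less_imp_le)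

section \<open>The step law as a probability measure\<close>

abbreviation step where "step \<equiv> step_law N r"

lemma space_step: "space step = carrier G"
  and sets_step: "sets step = Pow (carrier G)"
  by (simp_all add: step_law_def space_point_measure sets_point_measure)

lemma step_prob_nonneg: "x \<in> carrier G \<Longrightarrow> step_prob N r x \<ge> 0"
proof -
  assume x: "x \<in> carrier G"
  show ?thesis
  proof (cases "x = \<one>\<^bsub>G\<^esub>")
    case True
    then show ?thesis
      by (simp add: step_prob_def)
  next
    case False
    obtain k where k: "x \<in> hball (Suc k) - hball k"
      using x False exists_least_lemma[of "\<lambda>k. x \<in> hball k"]
      by (auto simp: carrier_eq_Union_hball hball_0)
    show ?thesis
      using step_prob_hball_diff[OF k] rate_nonneg N_ge2 by simp
  qed
qed

lemma emeasure_step_finite: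
  assumes "finite A" "A \<subseteq> carrier G"
  shows "emeasure step A = ennreal (\<Sum>x\<in>A. step_prob N r x)"
  unfolding step_law_def
  by (subst emeasure_point_measure_finite2) (use assms step_prob_nonneg in \<open>auto simp: subset_iff\<close>)

lemma measure_step_finite:
  assumes "finite A" "A \<subseteq> carrier G"
  shows "measure step A = (\<Sum>x\<in>A. step_prob N r x)"
  using emeasure_step_finite[OF assms] assms(2) step_prob_nonneg
  by (intro measure_eq_emeasure_eq_ennreal) (auto intro!: sum_nonneg)

sublocale step: prob_space step
proof
  \<comment> \<open>The total mass is obtained by continuity from below along the balls, whose
    masses are the partial sums of the rates.\<close>
  have "(\<lambda>k. emeasure step (hball k)) \<longlonglongrightarrow> emeasure step (\<Union>k. hball k)"
    by (rule Lim_emeasure_incseq)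
       (auto simp: sets_step incseq_def hball_mono dest: hball_subset[THEN subsetD] intro: hball_mono[THEN subsetD])
  moreover have "emeasure step (hball k) = ennreal (\<Sum>j<k. r (Suc j))" for k
    using emeasure_step_finite[OF finite_hball hball_subset] by (simp add: sum_step_prob_hball)
  moreover have "(\<lambda>k. ennreal (\<Sum>j<k. r (Suc j))) \<longlonglongrightarrow> ennreal 1"
    using rate_sums by (intro tendsto_ennrealI) (simp add: sums_def)
  ultimately show "emeasure step (space step) = 1"
    using LIMSEQ_unique by (fastforce simp: space_step carrier_eq_Union_hball)
qed

lemma measurable_step [simp]: "f \<in> measurable step M \<longleftrightarrow> f \<in> carrier G \<rightarrow> space M"
  by (simp add: step_law_def)

section \<open>Masses of translated balls and the eigenvalues of the step operator\<close>

lemma measure_step_translate_inside: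
  assumes "z \<in> hball k"
  shows "measure step {y \<in> carrier G. z \<otimes>\<^bsub>G\<^esub> y \<in> hball k} = (\<Sum>j<k. r (Suc j))"
proof -
  have z: "z \<in> carrier G"
    using assms hball_subset by blast
  have "{y \<in> carrier G. z \<otimes>\<^bsub>G\<^esub> y \<in> hball k} = hball k"
  proof (intro equalityI subsetI)
    fix y assume "y \<in> {y \<in> carrier G. z \<otimes>\<^bsub>G\<^esub> y \<in> hball k}"
    then have "y \<in> carrier G" "inv\<^bsub>G\<^esub> z \<otimes>\<^bsub>G\<^esub> (z \<otimes>\<^bsub>G\<^esub> y) \<in> hball k"
      using assms subgroup.m_closed[OF subgroup_hball] subgroup.m_inv_closed[OF subgroup_hball]
      by auto
    then show "y \<in> hball k"
      using z by (simp add: m_assoc[symmetric])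
  next
    fix y assume "y \<in> hball k"
    then show "y \<in> {y \<in> carrier G. z \<otimes>\<^bsub>G\<^esub> y \<in> hball k}"
      using assms subgroup.m_closed[OF subgroup_hball] hball_subset[THEN subsetD] by auto
  qed
  then show ?thesis
    using measure_step_finite[OF finite_hball hball_subset] by (simp add: sum_step_prob_hball)
qed

text \<open>The event is the coset of \<open>hball k\<close> through the inverse of
  \<open>z\<close>. The ultrametric property keeps this coset inside the sphere of radius
  \<open>Suc m\<close>, where \<open>step_prob\<close> is constant, so its mass is its cardinality
  \<open>N ^ k\<close> times that constant.\<close>

lemma measure_step_translate_outside:
  assumes z: "z \<in> hball (Suc m) - hball m" and "k \<le> m"
  shows "measure step {y \<in> carrier G. z \<otimes>\<^bsub>G\<^esub> y \<in> hball k}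
       = real N ^ k * (r (Suc m) / (real N ^ m * (real N - 1)))"
proof -
  have zG: "z \<in> carrier G"
    using z hball_subset by blast
  let ?T = "(\<lambda>w. inv\<^bsub>G\<^esub> z \<otimes>\<^bsub>G\<^esub> w) ` hball k"
  have T: "{y \<in> carrier G. z \<otimes>\<^bsub>G\<^esub> y \<in> hball k} = ?T"
  proof (intro equalityI subsetI)
    fix y assume y: "y \<in> {y \<in> carrier G. z \<otimes>\<^bsub>G\<^esub> y \<in> hball k}"
    then have "y = inv\<^bsub>G\<^esub> z \<otimes>\<^bsub>G\<^esub> (z \<otimes>\<^bsub>G\<^esub> y)"
      using zG by (simp add: m_assoc[symmetric])
    then show "y \<in> ?T"
      using y by blast
  next
    fix y assume "y \<in> ?T"
    then obtain w where w: "w \<in> hball k" "y = inv\<^bsub>G\<^esub> z \<otimes>\<^bsub>G\<^esub> w"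
      by blast
    moreover from w have "w \<in> carrier G"
      using hball_subset by blast
    ultimately show "y \<in> {y \<in> carrier G. z \<otimes>\<^bsub>G\<^esub> y \<in> hball k}"
      using zG by (simp add: m_assoc[symmetric])
  qed
  have T_diff: "?T \<subseteq> hball (Suc m) - hball m"
  proof (rule image_subsetI)
    fix w assume w: "w \<in> hball k"
    have wG: "w \<in> carrier G"
      using w hball_subset by blast
    have "inv\<^bsub>G\<^esub> z \<otimes>\<^bsub>G\<^esub> w \<in> hball (Suc m)"
      using z w hball_mono[of k "Suc m"] assms(2) subgroup.m_closed[OF subgroup_hball]
        subgroup.m_inv_closed[OF subgroup_hball] by (metis DiffD1 le_Suc_eq subsetD)
    moreover have "inv\<^bsub>G\<^esub> z \<otimes>\<^bsub>G\<^esub> w \<notin> hball m"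
    proof
      assume "inv\<^bsub>G\<^esub> z \<otimes>\<^bsub>G\<^esub> w \<in> hball m"
      moreover have "w \<in> hball m"
        using w hball_mono[OF assms(2)] by blast
      ultimately have "w \<otimes>\<^bsub>G\<^esub> inv\<^bsub>G\<^esub> (inv\<^bsub>G\<^esub> z \<otimes>\<^bsub>G\<^esub> w) \<in> hball m"
        using subgroup.m_closed[OF subgroup_hball] subgroup.m_inv_closed[OF subgroup_hball] by blast
      moreover have "w \<otimes>\<^bsub>G\<^esub> inv\<^bsub>G\<^esub> (inv\<^bsub>G\<^esub> z \<otimes>\<^bsub>G\<^esub> w) = z"
        using zG wG by (simp add: inv_mult_group m_assoc[symmetric])
      ultimately show False
        using z by simp
    qed
    ultimately show "inv\<^bsub>G\<^esub> z \<otimes>\<^bsub>G\<^esub> w \<in> hball (Suc m) - hball m"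
      by blast
  qed
  have "inj_on (\<lambda>w. inv\<^bsub>G\<^esub> z \<otimes>\<^bsub>G\<^esub> w) (hball k)"
    using zG hball_subset by (intro inj_onI) (metis inv_closed Units_eq Units_l_cancel subsetD)
  then have card: "card ?T = N ^ k"
    by (simp add: card_image card_hball)
  have "measure step ?T = (\<Sum>x\<in>?T. step_prob N r x)"
    using T_diff hball_subset by (intro measure_step_finite) (auto simp: finite_hball)
  also have "\<dots> = (\<Sum>x\<in>?T. r (Suc m) / (real N ^ m * (real N - 1)))"
    using T_diff by (intro sum.cong refl step_prob_hball_diff) blast
  finally show ?thesis
    by (simp add: T card)
qed

text \<open>The Fourier transform of the step law at a character trivial on \<open>hball k\<close>
  but not on \<open>hball (Suc k)\<close>: the inner ball contributes its full mass, the sphere of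
  radius \<open>Suc k\<close> contributes minus \<open>N ^ k\<close> times its density, and the
  larger spheres cancel.\<close>

definition eigenvalue :: "nat \<Rightarrow> real" where
  "eigenvalue k = (\<Sum>j<k. r (Suc j)) - r (Suc k) / (real N - 1)"

text \<open>The integral is a difference of normalised masses of translated balls. These are
  evaluated separately for \<open>z\<close> in the inner ball, on the sphere around it, and outside
  both.\<close>

lemma integral_hkernel_step:
  assumes z: "z \<in> carrier G"
  shows "(\<integral>y. hkernel k (z \<otimes>\<^bsub>G\<^esub> y) \<partial>step) = eigenvalue k * hkernel k z"
proof -
  define q where "q j = measure step {y \<in> carrier G. z \<otimes>\<^bsub>G\<^esub> y \<in> hball j}" for j
  have N: "real N > 1"
    using N_ge2 by simp
  have ind: "(\<integral>y. indicator (hball j) (z \<otimes>\<^bsub>G\<^esub> y) / c \<partial>step) = q j / c"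
    "integrable step (\<lambda>y. indicator (hball j) (z \<otimes>\<^bsub>G\<^esub> y) / c)" for j and c :: real
  proof -
    have "(\<integral>y. indicator (hball j) (z \<otimes>\<^bsub>G\<^esub> y) \<partial>step)
        = (\<integral>y. indicator {y \<in> carrier G. z \<otimes>\<^bsub>G\<^esub> y \<in> hball j} y \<partial>step)"
      by (rule Bochner_Integration.integral_cong) (auto simp: space_step indicator_def)
    also have "\<dots> = q j"
      unfolding q_def using Bochner_Integration.integral_indicator[of step]
      by (simp add: space_step Int_absorb2 Collect_conj_eq Int_commute)
    finally show "(\<integral>y. indicator (hball j) (z \<otimes>\<^bsub>G\<^esub> y) / c \<partial>step) = q j / c"
      by simp
    show "integrable step (\<lambda>y. indicator (hball j) (z \<otimes>\<^bsub>G\<^esub> y) / c)"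
      by (rule step.integrable_const_bound[where B = "1 / \<bar>c\<bar>"])
         (auto simp: indicator_def divide_simps)
  qed
  have *: "(\<integral>y. hkernel k (z \<otimes>\<^bsub>G\<^esub> y) \<partial>step) = q k / real N ^ k - q (Suc k) / real N ^ Suc k"
    unfolding hkernel_def by (subst Bochner_Integration.integral_diff) (simp_all only: ind)
  show ?thesis
  proof (cases "z \<in> hball (Suc k)")
    case z1: True
    then have q1: "q (Suc k) = (\<Sum>j<Suc k. r (Suc j))"
      unfolding q_def by (rule measure_step_translate_inside)
    show ?thesis
    proof (cases "z \<in> hball k")
      case z0: True
      then have q0: "q k = (\<Sum>j<k. r (Suc j))"
        unfolding q_def by (rule measure_step_translate_inside)
      show ?thesis
        unfolding * unfolding q0 q1 hkernel_def eigenvalue_def using z0 z1 N by (simp add: field_simps)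
    next
      case z0: False
      then have q0: "q k = real N ^ k * (r (Suc k) / (real N ^ k * (real N - 1)))"
        unfolding q_def using z1 by (intro measure_step_translate_outside) auto
      show ?thesis
        unfolding * unfolding q0 q1 hkernel_def eigenvalue_def using z0 z1 N by (simp add: field_simps)
    qed
  next
    case False
    then have "\<exists>m. z \<notin> hball m \<and> z \<in> hball (Suc m)"
      using z exists_least_lemma[of "\<lambda>k. z \<in> hball k"] hball_mono[of 0 "Suc k"]
      by (auto simp: carrier_eq_Union_hball)
    then obtain m where m: "z \<in> hball (Suc m) - hball m"
      by blast
    then have "Suc k \<le> m"
      using False hball_mono[of "Suc m" "Suc k"] by (metis DiffD1 not_less_eq_eq subsetD)
    \<comment> \<open>Outside, both translated balls lie in one sphere of constant density, so their
      masses are proportional to their sizes and the normalised masses cancel.\<close>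
    then have "q (Suc k) = real N ^ Suc k * (r (Suc m) / (real N ^ m * (real N - 1)))"
      "q k = real N ^ k * (r (Suc m) / (real N ^ m * (real N - 1)))"
      unfolding q_def using m by (intro measure_step_translate_outside; simp)+
    moreover have "hkernel k z = 0"
      using False hball_mono[of k "Suc k"] by (auto simp: hkernel_def indicator_def)
    ultimately show ?thesis
      unfolding * using N by simp
  qed
qed

lemma h_seq_pos: "h_seq N r (Suc k) > 0"
proof -
  have "r i \<ge> 0" if "i \<in> {Suc k + 1..}" for i
    using that rate_nonneg[of "i - 1"] by simp
  then have "(\<Sum>\<^sub>\<infinity>i\<in>{Suc k + 1..}. r i) \<ge> 0"
    by (rule infsum_nonneg)
  moreover have "real N / (real N - 1) * r (Suc k) > 0"
    using N_ge2 rate_pos by simp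
  ultimately show ?thesis
    unfolding h_seq_def by linarith
qed

text \<open>The tail in \<open>h_seq\<close> is one minus the partial sum up to
  \<open>r (Suc k)\<close>; writing \<open>N / (N - 1)\<close> as \<open>1 + 1 / (N - 1)\<close>
  restores the last rate of that sum. Thus \<open>h_seq\<close> gives the decay rates of the
  continuous-time walk.\<close>

lemma h_seq_eigenvalue: "h_seq N r (Suc k) = 1 - eigenvalue k"
proof -
  have "(\<lambda>j. r (Suc (j + Suc k))) sums (1 - (\<Sum>j<Suc k. r (Suc j)))"
    using sums_split_initial_segment[OF rate_sums] .
  then have "((\<lambda>j. r (Suc (j + Suc k))) has_sum (1 - (\<Sum>j<Suc k. r (Suc j)))) UNIV"
    using rate_nonneg by (intro norm_summable_imp_has_sum) (auto simp: sums_iff)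
  moreover have "bij_betw (\<lambda>j. Suc (j + Suc k)) UNIV {Suc k + 1..}"
    by (rule bij_betw_byWitness[where f' = "\<lambda>i. i - (k + 2)"]) auto
  ultimately have "(r has_sum (1 - (\<Sum>j<Suc k. r (Suc j)))) {Suc k + 1..}"
    using has_sum_reindex_bij_betw[of "\<lambda>j. Suc (j + Suc k)" UNIV "{Suc k + 1..}" r] by simp
  then have "(\<Sum>\<^sub>\<infinity>i\<in>{Suc k + 1..}. r i) = 1 - (\<Sum>j<Suc k. r (Suc j))"
    by (rule infsumI)
  moreover have "real N / (real N - 1) = 1 + 1 / (real N - 1)"
    using N_ge2 by (simp add: field_simps)
  ultimately show ?thesis
    by (simp add: h_seq_def eigenvalue_def algebra_simps)
qed

section \<open>The discrete-time walk\<close>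

sublocale steps: sequence_space step
  by unfold_locales

abbreviation steps where "steps \<equiv> \<Pi>\<^sub>M n\<in>(UNIV :: nat set). step"

sublocale step_steps: pair_prob_space step steps
  by unfold_locales

text \<open>The group is countable, so the product of the current position with the next step can be
  split over the possible positions.\<close>

lemma measurable_discrete_walk [measurable]:
  assumes "x \<in> carrier G"
  shows "(\<lambda>\<eta>. discrete_walk N x \<eta> n) \<in> measurable steps (count_space (carrier G))"
proof (induction n)
  case 0
  then show ?case
    using assms by simp
next
  case (Suc n)
  have "(\<lambda>\<eta>. g \<otimes>\<^bsub>G\<^esub> \<eta> n) \<in> measurable steps (count_space (carrier G))"
    if "g \<in> carrier G" for g
    using that by (intro measurable_compose[OF measurable_component_singleton[of n UNIV "\<lambda>_. step"]]) auto
  then show ?case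
    using measurable_compose_countable'[OF _ Suc.IH countable_carrier,
        of "\<lambda>g \<eta>. g \<otimes>\<^bsub>G\<^esub> \<eta> n" "count_space (carrier G)"]
    by simp
qed

text \<open>The recursion appends steps at the end; this form peels off the first one, as the
  first-step argument requires.\<close>

lemma discrete_walk_case_nat:
  "discrete_walk N x (case_nat s \<eta>) (Suc n) = discrete_walk N (x \<otimes>\<^bsub>G\<^esub> s) \<eta> n"
  by (induction n) auto

text \<open>First-step analysis: prepending an independent step preserves the law of the step
  sequence, so Fubini and the induction hypothesis at the shifted starting point leave one
  application of \<open>integral_hkernel_step\<close>.\<close>

lemma integral_hkernel_discrete_walk:
  assumes "x \<in> carrier G" "y \<in> carrier G"
  shows "(\<integral>\<eta>. hkernel k (inv\<^bsub>G\<^esub> y \<otimes>\<^bsub>G\<^esub> discrete_walk N x \<eta> n) \<partial>steps)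
       = eigenvalue k ^ n * hkernel k (inv\<^bsub>G\<^esub> y \<otimes>\<^bsub>G\<^esub> x)"
  using assms(1)
proof (induction n arbitrary: x)
  case 0
  then show ?case
    by (simp add: steps.P.prob_space)
next
  case (Suc n)
  let ?f = "\<lambda>g. hkernel k (inv\<^bsub>G\<^esub> y \<otimes>\<^bsub>G\<^esub> g)"
  have meas: "(\<lambda>\<eta>. ?f (discrete_walk N x \<eta> m)) \<in> borel_measurable steps"
    if "x \<in> carrier G" for x m
    by (rule measurable_compose[OF measurable_discrete_walk[OF that]]) simp
  have case_nat: "(\<lambda>(s, \<eta>). case_nat s \<eta>) \<in> measurable (step \<Otimes>\<^sub>M steps) steps"
    by measurable
  have "(\<integral>\<eta>. ?f (discrete_walk N x \<eta> (Suc n)) \<partial>steps)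
      = (\<integral>\<eta>. ?f (discrete_walk N x \<eta> (Suc n)) \<partial>distr (step \<Otimes>\<^sub>M steps) steps (\<lambda>(s, \<eta>). case_nat s \<eta>))"
    by (simp only: steps.PiM_iter)
  also have "\<dots> = (\<integral>p. ?f (discrete_walk N x (case p of (s, \<eta>) \<Rightarrow> case_nat s \<eta>) (Suc n)) \<partial>(step \<Otimes>\<^sub>M steps))"
    by (rule integral_distr[OF case_nat meas[OF Suc.prems]])
  also have "\<dots> = (\<integral>s. \<integral>\<eta>. ?f (discrete_walk N x (case (s, \<eta>) of (s, \<eta>) \<Rightarrow> case_nat s \<eta>) (Suc n)) \<partial>steps \<partial>step)"
  proof (rule step_steps.integral_fst'[symmetric])
    show "integrable (step \<Otimes>\<^sub>M steps)
      (\<lambda>p. ?f (discrete_walk N x (case p of (s, \<eta>) \<Rightarrow> case_nat s \<eta>) (Suc n)))"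
      using measurable_compose[OF case_nat meas[OF Suc.prems]]
      by (intro step_steps.P.integrable_const_bound[where B = "hkernel k \<one>\<^bsub>G\<^esub>"])
         (auto simp: abs_hkernel_le simp del: discrete_walk.simps)
  qed
  also have "\<dots> = (\<integral>s. \<integral>\<eta>. ?f (discrete_walk N (x \<otimes>\<^bsub>G\<^esub> s) \<eta> n) \<partial>steps \<partial>step)"
    by (simp only: discrete_walk_case_nat prod.case)
  also have "\<dots> = (\<integral>s. eigenvalue k ^ n * hkernel k (inv\<^bsub>G\<^esub> y \<otimes>\<^bsub>G\<^esub> x \<otimes>\<^bsub>G\<^esub> s) \<partial>step)"
    using Suc.prems assms(2)
    by (intro Bochner_Integration.integral_cong refl) (simp add: space_step Suc.IH m_assoc)
  also have "\<dots> = eigenvalue k ^ Suc n * hkernel k (inv\<^bsub>G\<^esub> y \<otimes>\<^bsub>G\<^esub> x)"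
    using Suc.prems assms(2) by (simp add: integral_hkernel_step)
  finally show ?case .
qed

section \<open>The continuous-time walk and its transition probabilities\<close>

lemma walk_space_eq: "walk_space N r = steps \<Otimes>\<^sub>M holding_times"
  by (simp add: walk_space_def)

sublocale walk: pair_prob_space steps holding_times
  by unfold_locales

lemma measurable_walk_at:
  assumes "x \<in> carrier G"
  shows "walk_at N x t \<in> measurable (walk_space N r) (count_space (carrier G))"
  unfolding walk_at_def walk_space_eq
proof (rule measurable_compose_countable)
  show "(\<lambda>\<omega>. discrete_walk N x (fst \<omega>) n) \<in> measurable (steps \<Otimes>\<^sub>M holding_times) (count_space (carrier G))" for n
    by (rule measurable_compose[OF measurable_fst measurable_discrete_walk[OF assms]])
qed measurable

text \<open>Clock and steps are independent. For a fixed clock the number of steps is fixed and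
  gives a power of the eigenvalue, which is then averaged by the Poisson generating
  function.\<close>

lemma integral_hkernel_walk_at:
  assumes "x \<in> carrier G" "y \<in> carrier G" "t \<ge> 0"
  shows "integrable (walk_space N r) (\<lambda>\<omega>. hkernel k (inv\<^bsub>G\<^esub> y \<otimes>\<^bsub>G\<^esub> walk_at N x t \<omega>))"
    and "(\<integral>\<omega>. hkernel k (inv\<^bsub>G\<^esub> y \<otimes>\<^bsub>G\<^esub> walk_at N x t \<omega>) \<partial>walk_space N r)
       = exp (- t * h_seq N r (Suc k)) * hkernel k (inv\<^bsub>G\<^esub> y \<otimes>\<^bsub>G\<^esub> x)"
proof -
  let ?f = "\<lambda>g. hkernel k (inv\<^bsub>G\<^esub> y \<otimes>\<^bsub>G\<^esub> g)"
  have "(\<lambda>\<omega>. ?f (walk_at N x t \<omega>)) \<in> borel_measurable (walk_space N r)"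
    by (rule measurable_compose[OF measurable_walk_at[OF assms(1)]]) simp
  then show int: "integrable (walk_space N r) (\<lambda>\<omega>. ?f (walk_at N x t \<omega>))"
    unfolding walk_space_eq
    by (intro walk.P.integrable_const_bound[where B = "hkernel k \<one>\<^bsub>G\<^esub>"]) (auto simp: abs_hkernel_le)
  have "(\<integral>\<omega>. ?f (walk_at N x t \<omega>) \<partial>walk_space N r)
      = (\<integral>\<tau>. \<integral>\<eta>. ?f (walk_at N x t (\<eta>, \<tau>)) \<partial>steps \<partial>holding_times)"
    using walk.integral_snd[of "\<lambda>\<eta> \<tau>. ?f (walk_at N x t (\<eta>, \<tau>))"] int
    by (simp add: walk_space_eq case_prod_beta')
  also have "\<dots> = (\<integral>\<tau>. eigenvalue k ^ jump_count \<tau> t * hkernel k (inv\<^bsub>G\<^esub> y \<otimes>\<^bsub>G\<^esub> x) \<partial>holding_times)"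
    using assms by (simp add: walk_at_def integral_hkernel_discrete_walk)
  also have "\<dots> = exp (- t * h_seq N r (Suc k)) * hkernel k (inv\<^bsub>G\<^esub> y \<otimes>\<^bsub>G\<^esub> x)"
    using assms(3) by (simp add: expectation_power_jump_count h_seq_eigenvalue)
  finally show "(\<integral>\<omega>. ?f (walk_at N x t \<omega>) \<partial>walk_space N r)
      = exp (- t * h_seq N r (Suc k)) * hkernel k (inv\<^bsub>G\<^esub> y \<otimes>\<^bsub>G\<^esub> x)" .
qed

text \<open>Being at \<open>y\<close> means that the displacement from \<open>y\<close> is the
  identity. By \<open>hkernel_sums\<close> the indicator of this event is a sum of kernels, which is
  integrated term by term under the uniform bound \<open>abs_hkernel_le\<close>.\<close>

theorem trans_prob_eq:
  assumes x: "x \<in> carrier G" and y: "y \<in> carrier G" and t: "t \<ge> 0"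
  shows "trans_prob N r t x y
       = (\<Sum>k. exp (- t * h_seq N r (Suc k)) * hkernel k (inv\<^bsub>G\<^esub> y \<otimes>\<^bsub>G\<^esub> x))"
proof -
  let ?M = "walk_space N r" and ?f = "\<lambda>k \<omega>. hkernel k (inv\<^bsub>G\<^esub> y \<otimes>\<^bsub>G\<^esub> walk_at N x t \<omega>)"
  have "prob_space ?M"
    unfolding walk_space_eq by unfold_locales
  then interpret M: prob_space ?M .
  have ind: "indicator {\<one>\<^bsub>G\<^esub>} (inv\<^bsub>G\<^esub> y \<otimes>\<^bsub>G\<^esub> walk_at N x t \<omega>)
      = (indicator {\<omega> \<in> space ?M. walk_at N x t \<omega> = y} \<omega> :: real)" if "\<omega> \<in> space ?M" for \<omega>
  proof -
    have "walk_at N x t \<omega> \<in> carrier G"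
      using measurable_space[OF measurable_walk_at[OF x] that] by simp
    then have "inv\<^bsub>G\<^esub> y \<otimes>\<^bsub>G\<^esub> walk_at N x t \<omega> = \<one>\<^bsub>G\<^esub> \<longleftrightarrow> walk_at N x t \<omega> = y"
      using y by (metis inv_closed inv_equality inv_inv l_inv)
    then show ?thesis
      using that by (simp add: indicator_def)
  qed
  have "trans_prob N r t x y = (\<integral>\<omega>. indicator {\<omega> \<in> space ?M. walk_at N x t \<omega> = y} \<omega> \<partial>?M)"
    by (simp add: trans_prob_def Int_absorb2)
  also have "\<dots> = (\<integral>\<omega>. (\<Sum>k. ?f k \<omega>) \<partial>?M)"
    by (intro Bochner_Integration.integral_cong refl)
       (simp only: hkernel_sums[THEN sums_unique, symmetric] ind)
  also have "\<dots> = (\<Sum>k. \<integral>\<omega>. ?f k \<omega> \<partial>?M)"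
  proof (rule integral_suminf)
    show "integrable ?M (?f k)" for k
      by (rule integral_hkernel_walk_at[OF assms])
    show "AE \<omega> in ?M. summable (\<lambda>k. norm (?f k \<omega>))"
      by (intro AE_I2 summable_comparison_test[OF _ summable_hkernel_one]) (auto simp: abs_hkernel_le)
    show "summable (\<lambda>k. \<integral>\<omega>. norm (?f k \<omega>) \<partial>?M)"
    proof (rule summable_comparison_test[OF _ summable_hkernel_one])
      have "(\<integral>\<omega>. \<bar>?f k \<omega>\<bar> \<partial>?M) \<le> hkernel k \<one>\<^bsub>G\<^esub>" for k
        by (intro M.integral_le_const integrable_abs integral_hkernel_walk_at[OF assms])
           (simp add: abs_hkernel_le)
      then show "\<exists>n. \<forall>k\<ge>n. norm (\<integral>\<omega>. norm (?f k \<omega>) \<partial>?M) \<le> hkernel k \<one>\<^bsub>G\<^esub>"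
        by simp
    qed
  qed
  also have "\<dots> = (\<Sum>k. exp (- t * h_seq N r (Suc k)) * hkernel k (inv\<^bsub>G\<^esub> y \<otimes>\<^bsub>G\<^esub> x))"
    by (simp only: integral_hkernel_walk_at[OF assms])
  finally show ?thesis .
qed

text \<open>Every kernel is maximal at the identity and the exponential coefficients are positive,
  so the bound holds term by term. Those coefficients are at most 1, hence summability.\<close>

lemma trans_prob_le_diagonal:
  assumes "x \<in> carrier G" "y \<in> carrier G" "t \<ge> 0"
  shows "trans_prob N r t x y \<le> (\<Sum>k. exp (- t * h_seq N r (Suc k)) * hkernel k \<one>\<^bsub>G\<^esub>)"
    and "summable (\<lambda>k. exp (- t * h_seq N r (Suc k)) * hkernel k \<one>\<^bsub>G\<^esub>)"
proof -
  let ?e = "\<lambda>k. exp (- t * h_seq N r (Suc k))"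
  have le: "\<bar>?e k * hkernel k z\<bar> \<le> ?e k * hkernel k \<one>\<^bsub>G\<^esub>" for k z
    by (simp add: abs_mult abs_hkernel_le)
  have nonneg: "0 \<le> hkernel k \<one>\<^bsub>G\<^esub>" for k
    using abs_hkernel_le[of k "\<one>\<^bsub>G\<^esub>"] by linarith
  show summable: "summable (\<lambda>k. ?e k * hkernel k \<one>\<^bsub>G\<^esub>)"
    using assms(3) h_seq_pos[THEN less_imp_le] nonneg
    by (intro summable_comparison_test[OF _ summable_hkernel_one] exI[of _ 0])
       (auto intro!: mult_left_le_one_le)
  have "summable (\<lambda>k. ?e k * hkernel k (inv\<^bsub>G\<^esub> y \<otimes>\<^bsub>G\<^esub> x))"
    using le by (intro summable_comparison_test[OF _ summable]) auto
  then show "trans_prob N r t x y \<le> (\<Sum>k. ?e k * hkernel k \<one>\<^bsub>G\<^esub>)"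
    unfolding trans_prob_eq[OF assms]
    using le summable by (intro suminf_le) (auto simp: abs_le_iff)
qed

end

subsection \<open>Green operator powers\<close>

text \<open>The Gamma integral after the substitution of \<open>h * t\<close> for
  \<open>t\<close>.\<close>

lemma nn_integral_powr_exp:
  assumes "a > 0" "h > (0 :: real)"
  shows "(\<integral>\<^sup>+t\<in>{0<..}. ennreal (t powr (a - 1) * exp (- t * h)) \<partial>lborel) = ennreal (Gamma a / h powr a)"
proof -
  let ?f = "\<lambda>t. ennreal (indicator {0..} t * t powr (a - 1) / exp t)"
  have "ennreal (Gamma a) = (\<integral>\<^sup>+t. ?f t \<partial>lborel)"
    by (rule Gamma_conv_nn_integral_real) fact
  also have "\<dots> = ennreal h * (\<integral>\<^sup>+t. ?f (0 + h * t) \<partial>lborel)"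
    using assms(2) by (subst nn_integral_real_affine[where c = h and t = 0]) auto
  also have "(\<integral>\<^sup>+t. ?f (0 + h * t) \<partial>lborel)
      = (\<integral>\<^sup>+t. ennreal (h powr (a - 1)) * (ennreal (t powr (a - 1) * exp (- t * h)) * indicator {0<..} t) \<partial>lborel)"
  proof (rule nn_integral_cong)
    fix t :: real
    \<comment> \<open>At \<open>t = 0\<close> the indicators of the two half-lines differ, but
      \<open>0 powr (a - 1)\<close> is 0, so both sides vanish there.\<close>
    consider "t < 0" | "t = 0" | "t > 0"
      by linarith
    then show "?f (0 + h * t)
        = ennreal (h powr (a - 1)) * (ennreal (t powr (a - 1) * exp (- t * h)) * indicator {0<..} t)"
    proof cases
      case 1
      then show ?thesis
        using assms(2) by (simp add: indicator_def zero_le_mult_iff)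
    next
      case 3
      then show ?thesis
        using assms(2)
        by (simp add: indicator_def powr_mult ennreal_mult'[symmetric] exp_minus field_simps)
    qed simp
  qed
  also have "\<dots> = ennreal (h powr (a - 1)) * (\<integral>\<^sup>+t\<in>{0<..}. ennreal (t powr (a - 1) * exp (- t * h)) \<partial>lborel)"
    by (rule nn_integral_cmult) measurable
  finally have "ennreal (Gamma a) = ennreal (h * h powr (a - 1))
      * (\<integral>\<^sup>+t\<in>{0<..}. ennreal (t powr (a - 1) * exp (- t * h)) \<partial>lborel)"
    using assms(2) by (simp add: ennreal_mult' mult.assoc)
  also have "h * h powr (a - 1) = h powr a"
    using assms(2) by (simp add: powr_mult_base)
  finally have "ennreal (inverse (h powr a)) * ennreal (Gamma a)
      = ennreal (inverse (h powr a)) * ennreal (h powr a)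
        * (\<integral>\<^sup>+t\<in>{0<..}. ennreal (t powr (a - 1) * exp (- t * h)) \<partial>lborel)"
    by (simp add: mult.assoc)
  then show ?thesis
    using assms by (simp add: ennreal_mult'[symmetric] Gamma_real_pos less_imp_le field_simps)
qed

context hierarchical_walk
begin

text \<open>For \<open>t \<ge> 0\<close> this is the return probability, by
  \<open>trans_prob_eq\<close> with equal endpoints.\<close>

abbreviation diagonal :: "real \<Rightarrow> real" where
  "diagonal t \<equiv> \<Sum>k. exp (- t * h_seq N r (Suc k)) * hkernel k \<one>\<^bsub>G\<^esub>"

lemma hkernel_one_pos: "hkernel k \<one>\<^bsub>G\<^esub> > 0"
  using N_ge2 by (simp add: hkernel_one)

text \<open>All terms are nonnegative, so sum and integral commute and each term is a Gamma integral
  with rate \<open>h_seq N r (Suc k)\<close>.\<close>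

lemma nn_integral_diagonal:
  assumes "\<zeta> > 0"
  shows "(\<integral>\<^sup>+t\<in>{0<..}. ennreal (t powr (\<zeta> - 1) * diagonal t) \<partial>lborel)
       = (\<Sum>k. ennreal (hkernel k \<one>\<^bsub>G\<^esub> * (Gamma \<zeta> / h_seq N r (Suc k) powr \<zeta>)))"
proof -
  let ?g = "\<lambda>k t. ennreal (t powr (\<zeta> - 1) * exp (- t * h_seq N r (Suc k))) * indicator {0<..} t"
  have "(\<integral>\<^sup>+t\<in>{0<..}. ennreal (t powr (\<zeta> - 1) * diagonal t) \<partial>lborel)
      = (\<integral>\<^sup>+t. (\<Sum>k. ennreal (hkernel k \<one>\<^bsub>G\<^esub>) * ?g k t) \<partial>lborel)"
  proof (rule nn_integral_cong)
    fix t :: real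
    show "ennreal (t powr (\<zeta> - 1) * diagonal t) * indicator {0<..} t
        = (\<Sum>k. ennreal (hkernel k \<one>\<^bsub>G\<^esub>) * ?g k t)"
    proof (cases "t > 0")
      case True
      let ?d = "\<lambda>k. t powr (\<zeta> - 1) * (exp (- t * h_seq N r (Suc k)) * hkernel k \<one>\<^bsub>G\<^esub>)"
      have summable: "summable (\<lambda>k. exp (- t * h_seq N r (Suc k)) * hkernel k \<one>\<^bsub>G\<^esub>)"
        using trans_prob_le_diagonal(2)[of "\<one>\<^bsub>G\<^esub>" "\<one>\<^bsub>G\<^esub>" t] True by simp
      have "t powr (\<zeta> - 1) * diagonal t = (\<Sum>k. ?d k)"
        using summable by (rule suminf_mult[symmetric])
      then have "ennreal (t powr (\<zeta> - 1) * diagonal t) = (\<Sum>k. ennreal (?d k))"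
        using summable_mult[OF summable, of "t powr (\<zeta> - 1)"] hkernel_one_pos[THEN less_imp_le]
        by (simp add: suminf_ennreal2)
      also have "\<dots> = (\<Sum>k. ennreal (hkernel k \<one>\<^bsub>G\<^esub>) * ?g k t)"
        using True hkernel_one_pos[THEN less_imp_le]
        by (intro suminf_cong) (simp add: ennreal_mult'[symmetric] mult_ac)
      finally show ?thesis
        using True by simp
    qed simp
  qed
  also have "\<dots> = (\<Sum>k. \<integral>\<^sup>+t. ennreal (hkernel k \<one>\<^bsub>G\<^esub>) * ?g k t \<partial>lborel)"
    by (rule nn_integral_suminf) measurable
  also have "\<dots> = (\<Sum>k. ennreal (hkernel k \<one>\<^bsub>G\<^esub>) * ennreal (Gamma \<zeta> / h_seq N r (Suc k) powr \<zeta>))"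
    using nn_integral_powr_exp[OF assms h_seq_pos] by (simp add: nn_integral_cmult)
  also have "\<dots> = (\<Sum>k. ennreal (hkernel k \<one>\<^bsub>G\<^esub> * (Gamma \<zeta> / h_seq N r (Suc k) powr \<zeta>)))"
    using hkernel_one_pos[THEN less_imp_le] by (intro suminf_cong ennreal_mult'[symmetric])
  finally show ?thesis .
qed

lemma semigroup_op_eq_sum:
  assumes "finite {y \<in> carrier G. \<phi> y \<noteq> 0}"
  shows "semigroup_op N r t \<phi> x = (\<Sum>y | y \<in> carrier G \<and> \<phi> y \<noteq> 0. trans_prob N r t x y * \<phi> y)"
proof -
  have "semigroup_op N r t \<phi> x = (\<Sum>\<^sub>\<infinity>y\<in>{y \<in> carrier G. \<phi> y \<noteq> 0}. trans_prob N r t x y * \<phi> y)"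
    unfolding semigroup_op_def by (rule infsum_cong_neutral) auto
  then show ?thesis
    using assms by simp
qed

text \<open>Testing with the unit mass at the identity produces the return integral. Conversely, the
  diagonal dominates all transition probabilities, so \<open>semigroup_op\<close> is at most
  \<open>diagonal t\<close> times the total mass of the test function.\<close>

lemma green_power_finite_iff_nn_integral:
  assumes "\<zeta> > 0"
  shows "green_power_finite N r \<zeta>
     \<longleftrightarrow> (\<integral>\<^sup>+t\<in>{0<..}. ennreal (t powr (\<zeta> - 1) * diagonal t) \<partial>lborel) < \<infinity>"
    (is "_ \<longleftrightarrow> ?I < \<infinity>")
proof
  assume fin: "green_power_finite N r \<zeta>"
  let ?\<phi> = "indicator {\<one>\<^bsub>G\<^esub>} :: _ \<Rightarrow> real"
  have supp: "{y \<in> carrier G. ?\<phi> y \<noteq> 0} = {\<one>\<^bsub>G\<^esub>}"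
    by (auto simp: indicator_def)
  then have "semigroup_op N r t ?\<phi> \<one>\<^bsub>G\<^esub> = trans_prob N r t \<one>\<^bsub>G\<^esub> \<one>\<^bsub>G\<^esub>" for t
    by (subst semigroup_op_eq_sum) simp_all
  then have "semigroup_op N r t ?\<phi> \<one>\<^bsub>G\<^esub> = diagonal t" if "t > 0" for t
    using that trans_prob_eq[of "\<one>\<^bsub>G\<^esub>" "\<one>\<^bsub>G\<^esub>" t] by simp
  then have "ennreal (t powr (\<zeta> - 1) * semigroup_op N r t ?\<phi> \<one>\<^bsub>G\<^esub>) * indicator {0<..} t
      = ennreal (t powr (\<zeta> - 1) * diagonal t) * indicator {0<..} t" for t
    by (cases "t > 0") simp_all
  then have "green_power N r \<zeta> ?\<phi> \<one>\<^bsub>G\<^esub> = ennreal (1 / Gamma \<zeta>) * ?I"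
    unfolding green_power_def by (simp only:)
  moreover have "green_power N r \<zeta> ?\<phi> \<one>\<^bsub>G\<^esub> < \<infinity>"
  proof -
    have "(\<forall>x\<in>carrier G. 0 \<le> ?\<phi> x) \<and> finite {x \<in> carrier G. ?\<phi> x \<noteq> 0}"
      unfolding supp by simp
    then show ?thesis
      using fin one_closed unfolding green_power_finite_def by blast
  qed
  ultimately show "?I < \<infinity>"
    using Gamma_real_pos[OF assms] by (auto simp: ennreal_mult_less_top)
next
  assume I: "?I < \<infinity>"
  show "green_power_finite N r \<zeta>"
    unfolding green_power_finite_def
  proof (intro allI impI ballI, elim conjE)
    fix \<phi> :: "(nat \<Rightarrow> int) \<Rightarrow> real" and x
    assume nonneg: "\<forall>x\<in>carrier G. 0 \<le> \<phi> x" and fin: "finite {x \<in> carrier G. \<phi> x \<noteq> 0}"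
      and x: "x \<in> carrier G"
    define C where "C = (\<Sum>y | y \<in> carrier G \<and> \<phi> y \<noteq> 0. \<phi> y)"
    have "C \<ge> 0"
      unfolding C_def using nonneg by (intro sum_nonneg) auto
    have le: "semigroup_op N r t \<phi> x \<le> C * diagonal t" if "t > 0" for t
    proof -
      have "semigroup_op N r t \<phi> x \<le> (\<Sum>y | y \<in> carrier G \<and> \<phi> y \<noteq> 0. diagonal t * \<phi> y)"
        unfolding semigroup_op_eq_sum[OF fin]
        using nonneg trans_prob_le_diagonal(1)[OF x _ less_imp_le[OF that]]
        by (intro sum_mono mult_right_mono) auto
      also have "\<dots> = C * diagonal t"
        unfolding C_def sum_distrib_right by (intro sum.cong refl mult.commute)
      finally show ?thesis .
    qed
    have "(\<integral>\<^sup>+t\<in>{0<..}. ennreal (t powr (\<zeta> - 1) * semigroup_op N r t \<phi> x) \<partial>lborel)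
        \<le> (\<integral>\<^sup>+t. ennreal C * (ennreal (t powr (\<zeta> - 1) * diagonal t) * indicator {0<..} t) \<partial>lborel)"
    proof (rule nn_integral_mono)
      fix t :: real
      show "ennreal (t powr (\<zeta> - 1) * semigroup_op N r t \<phi> x) * indicator {0<..} t
          \<le> ennreal C * (ennreal (t powr (\<zeta> - 1) * diagonal t) * indicator {0<..} t)"
      proof (cases "t > 0")
        case True
        then have "t powr (\<zeta> - 1) * semigroup_op N r t \<phi> x \<le> C * (t powr (\<zeta> - 1) * diagonal t)"
          using mult_left_mono[OF le[OF True], of "t powr (\<zeta> - 1)"] by (simp add: mult_ac)
        then have "ennreal (t powr (\<zeta> - 1) * semigroup_op N r t \<phi> x)
            \<le> ennreal C * ennreal (t powr (\<zeta> - 1) * diagonal t)"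
          using \<open>C \<ge> 0\<close> by (subst ennreal_mult'[symmetric]) (auto intro: ennreal_leI)
        then show ?thesis
          using True by simp
      qed simp
    qed
    also have "\<dots> = ennreal C * ?I"
      by (rule nn_integral_cmult) measurable
    also have "\<dots> < \<infinity>"
      using I by (simp add: ennreal_mult_less_top)
    finally show "green_power N r \<zeta> \<phi> x < \<infinity>"
      by (simp add: green_power_def ennreal_mult_less_top)
  qed
qed

text \<open>By \<open>hkernel_one\<close> the terms of the integrated series are
  \<open>(N - 1) * Gamma \<zeta>\<close> times those of the stated series, with
  \<open>j = Suc k\<close>.\<close>

theorem green_power_finite_iff:
  assumes "\<zeta> > 0"
  shows "green_power_finite N r \<zeta> \<longleftrightarrow>
    (\<lambda>j. 1 / (real N ^ j * h_seq N r j powr \<zeta>)) summable_on {1..}"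
proof -
  let ?a = "\<lambda>k. 1 / (real N ^ Suc k * h_seq N r (Suc k) powr \<zeta>)"
  let ?b = "\<lambda>k. hkernel k \<one>\<^bsub>G\<^esub> * (Gamma \<zeta> / h_seq N r (Suc k) powr \<zeta>)"
  have pos: "Gamma \<zeta> > 0" "real N > 1"
    using assms Gamma_real_pos N_ge2 by auto
  have b_nonneg: "?b k \<ge> 0" for k
    using pos hkernel_one_pos[of k] by simp
  have "(\<Sum>k. ennreal (?b k)) < \<infinity> \<longleftrightarrow> summable ?b"
  proof
    show "summable ?b" if "(\<Sum>k. ennreal (?b k)) < \<infinity>"
      by (rule summable_suminf_not_top[OF b_nonneg]) (use that in simp)
    show "(\<Sum>k. ennreal (?b k)) < \<infinity>" if "summable ?b"
      using ennreal_suminf_neq_top[OF that b_nonneg] by (simp add: less_top)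
  qed
  also have "\<dots> \<longleftrightarrow> summable (\<lambda>k. (real N - 1) * Gamma \<zeta> * ?a k)"
    by (simp add: hkernel_one)
  also have "\<dots> \<longleftrightarrow> summable ?a"
    using pos by (subst summable_cmult_iff) simp
  also have "\<dots> \<longleftrightarrow> ?a summable_on UNIV"
    using pos by (intro summable_on_UNIV_nonneg_real_iff[symmetric]) simp
  also have "\<dots> \<longleftrightarrow> (\<lambda>j. 1 / (real N ^ j * h_seq N r j powr \<zeta>)) summable_on {1..}"
    by (rule summable_on_reindex_bij_betw) (rule bij_betw_byWitness[where f' = "\<lambda>i. i - 1"]; auto)
  finally show ?thesis
    unfolding green_power_finite_iff_nn_integral[OF assms] nn_integral_diagonal[OF assms] .
qed

end

subsection \<open>Walks given by weights\<close>

text \<open>Serves finite bounds and infinity alike: a real number always fits strictly between the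
  limsup and \<open>y\<close>.\<close>

lemma limsup_ereal_less_imp_eventually:
  fixes f :: "nat \<Rightarrow> real"
  assumes "limsup (\<lambda>j. ereal (f j)) < y"
  obtains q where "ereal q < y" "\<forall>\<^sub>F j in sequentially. f j < q"
proof -
  obtain q where q: "limsup (\<lambda>j. ereal (f j)) < ereal q" "ereal q < y"
    using ereal_dense2[OF assms] by blast
  have "\<forall>\<^sub>F j in sequentially. ereal (f j) < ereal q"
    using q(1) by (rule Limsup_lessD)
  then show thesis
    using q(2) that by simp
qed

lemma limsup_ereal_le:
  fixes f :: "nat \<Rightarrow> real"
  assumes "\<forall>\<^sub>F j in sequentially. f j \<le> q"
  shows "limsup (\<lambda>j. ereal (f j)) \<le> ereal q"
  using assms by (intro Limsup_bounded) simp

lemma summable_nonneg_comparison: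
  fixes f g :: "nat \<Rightarrow> real"
  assumes "\<And>j. 0 \<le> f j" "\<forall>\<^sub>F j in sequentially. f j \<le> K * g j" "summable g"
  shows "summable f"
  by (rule summable_comparison_test_ev[OF _ summable_mult[OF assms(3), of K]])
     (use assms(1,2) in \<open>auto elim!: eventually_mono\<close>)

locale mu_walk =
  fixes N :: nat and \<mu> :: real and c :: "nat \<Rightarrow> real"
  assumes N_ge2: "N \<ge> 2" and mu_pos: "\<mu> > 0" and c_pos: "\<And>j. c j > 0"
    and weights_summable: "mu_weights_summable N \<mu> c"
begin

text \<open>The unnormalised rate for hierarchical distance \<open>j + 1\<close>.\<close>

definition weight :: "nat \<Rightarrow> real" where
  "weight j = c j * real N powr (- real j / \<mu>)"

text \<open>The normalising constant D.\<close>

definition norm_const :: real where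
  "norm_const = 1 / (\<Sum>\<^sub>\<infinity>j. weight j)"

abbreviation rate where "rate \<equiv> mu_rates N \<mu> c"

lemma weight_pos: "weight j > 0"
  using N_ge2 c_pos by (simp add: weight_def)

lemma summable_on_weight: "weight summable_on A"
  using weights_summable summable_on_subset_banach[of weight UNIV A]
  by (simp add: mu_weights_summable_def weight_def[abs_def])

lemma infsum_weight_pos: "(\<Sum>\<^sub>\<infinity>j. weight j) > 0"
proof -
  have "weight 0 = (\<Sum>\<^sub>\<infinity>j\<in>{0}. weight j)"
    by simp
  also have "\<dots> \<le> (\<Sum>\<^sub>\<infinity>j. weight j)"
    by (rule infsum_mono_neutral) (auto simp: summable_on_weight weight_pos less_imp_le)
  finally show ?thesis
    using weight_pos[of 0] by linarith
qed

lemma norm_const_pos: "norm_const > 0"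
  using infsum_weight_pos by (simp add: norm_const_def)

lemma rate_Suc: "rate (Suc j) = norm_const * weight j"
  by (simp add: mu_rates_def norm_const_def weight_def)

sublocale hierarchical_walk N rate
proof
  have "(weight has_sum (\<Sum>\<^sub>\<infinity>j. weight j)) UNIV"
    using summable_on_weight by (rule has_sum_infsum)
  then have "(\<lambda>j. norm_const * weight j) sums (norm_const * (\<Sum>\<^sub>\<infinity>j. weight j))"
    by (intro sums_mult has_sum_imp_sums)
  then show "(\<lambda>j. rate (Suc j)) sums 1"
    using infsum_weight_pos by (simp add: rate_Suc norm_const_def)
qed (use N_ge2 rate_Suc weight_pos norm_const_pos in auto)

lemma weight_tail: "c_tail N \<mu> c j = real N powr (real j / \<mu>) * (\<Sum>\<^sub>\<infinity>i\<in>{j+1..}. weight i)"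
proof -
  have "c i / real N powr (real (i - j) / \<mu>) = real N powr (real j / \<mu>) * weight i"
    if "i \<in> {j+1..}" for i
  proof -
    \<comment> \<open>Subtraction on naturals is exact here because \<open>i > j\<close>, so the
      power splits into a factor of the weight and one that depends on \<open>j\<close>
      alone.\<close>
    have "real (i - j) / \<mu> = real i / \<mu> - real j / \<mu>"
      using that by (simp add: of_nat_diff diff_divide_distrib)
    then have "real N powr (real (i - j) / \<mu>) = real N powr (real i / \<mu>) / real N powr (real j / \<mu>)"
      by (simp only: powr_diff)
    then show ?thesis
      by (simp add: weight_def powr_minus divide_inverse)
  qed
  then have "c_tail N \<mu> c j = (\<Sum>\<^sub>\<infinity>i\<in>{j+1..}. real N powr (real j / \<mu>) * weight i)"
    unfolding c_tail_def by (rule infsum_cong)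
  then show ?thesis
    by (simp add: infsum_cmult_right')
qed

lemma c_tail_nonneg: "c_tail N \<mu> c j \<ge> 0"
  unfolding weight_tail by (intro mult_nonneg_nonneg infsum_nonneg) (auto simp: weight_pos less_imp_le)

lemma rate_tail:
  "(\<Sum>\<^sub>\<infinity>i\<in>{Suc j + 1..}. rate i) = norm_const * real N powr (- real j / \<mu>) * c_tail N \<mu> c j"
proof -
  have "bij_betw Suc {j+1..} {Suc j + 1..}"
    by (rule bij_betw_byWitness[where f' = "\<lambda>i. i - 1"]) auto
  then have "(\<Sum>\<^sub>\<infinity>i\<in>{Suc j + 1..}. rate i) = (\<Sum>\<^sub>\<infinity>i\<in>{j+1..}. rate (Suc i))"
    by (rule infsum_reindex_bij_betw[symmetric])
  also have "\<dots> = norm_const * (\<Sum>\<^sub>\<infinity>i\<in>{j+1..}. weight i)"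
    by (simp add: rate_Suc infsum_cmult_right')
  also have "\<dots> = norm_const * real N powr (- real j / \<mu>) * c_tail N \<mu> c j"
    using N_ge2 by (simp add: weight_tail powr_minus)
  finally show ?thesis .
qed

lemma h_seq_eq_d_seq:
  "h_seq N rate (Suc j) = norm_const * real N powr (- real j / \<mu>) * d_seq N \<mu> c j"
  unfolding h_seq_def rate_tail d_seq_def rate_Suc weight_def by (simp add: algebra_simps)

lemma d_seq_pos: "d_seq N \<mu> c j > 0"
proof -
  have "0 < norm_const * real N powr (- real j / \<mu>)"
    using norm_const_pos N_ge2 by simp
  then show ?thesis
    using h_seq_pos[of j] unfolding h_seq_eq_d_seq by (blast intro: zero_less_mult_pos)
qed

lemma summable_on_h_seq_iff_d_seq:
  "(\<lambda>j. 1 / (real N ^ j * h_seq N rate j powr \<zeta>)) summable_on {1..} \<longleftrightarrow>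
   (\<lambda>j. 1 / (real N powr (real j * (\<mu> - \<zeta>) / \<mu>) * d_seq N \<mu> c j powr \<zeta>)) summable_on UNIV"
proof -
  \<comment> \<open>The factor \<open>N\<close> comes from the index shift, and
    \<open>norm_const powr \<zeta>\<close> from the constant relating \<open>h_seq\<close> to
    \<open>d_seq\<close>.\<close>
  let ?K = "1 / (real N * norm_const powr \<zeta>)"
  have "bij_betw Suc UNIV {1..}"
    by (rule bij_betw_byWitness[where f' = "\<lambda>i. i - 1"]) auto
  then have "(\<lambda>j. 1 / (real N ^ j * h_seq N rate j powr \<zeta>)) summable_on {1..} \<longleftrightarrow>
      (\<lambda>j. 1 / (real N ^ Suc j * h_seq N rate (Suc j) powr \<zeta>)) summable_on UNIV"
    by (rule summable_on_reindex_bij_betw[symmetric])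
  also have "(\<lambda>j. 1 / (real N ^ Suc j * h_seq N rate (Suc j) powr \<zeta>)) =
      (\<lambda>j. ?K * (1 / (real N powr (real j * (\<mu> - \<zeta>) / \<mu>) * d_seq N \<mu> c j powr \<zeta>)))"
  proof
    fix j
    have "real j + - real j / \<mu> * \<zeta> = real j * (\<mu> - \<zeta>) / \<mu>"
      using mu_pos by (simp add: field_simps)
    then have "real N ^ j * real N powr (- real j / \<mu> * \<zeta>) = real N powr (real j * (\<mu> - \<zeta>) / \<mu>)"
      using N_ge2 by (simp add: powr_realpow[symmetric] powr_add[symmetric])
    then have "real N ^ Suc j * h_seq N rate (Suc j) powr \<zeta> = real N * norm_const powr \<zeta> *
        (real N powr (real j * (\<mu> - \<zeta>) / \<mu>) * d_seq N \<mu> c j powr \<zeta>)"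
      using norm_const_pos d_seq_pos[of j]
      by (simp add: h_seq_eq_d_seq powr_mult powr_powr less_imp_le mult_ac)
    then show "1 / (real N ^ Suc j * h_seq N rate (Suc j) powr \<zeta>)
        = ?K * (1 / (real N powr (real j * (\<mu> - \<zeta>) / \<mu>) * d_seq N \<mu> c j powr \<zeta>))"
      by simp
  qed
  also have "\<dots> summable_on UNIV \<longleftrightarrow>
      (\<lambda>j. 1 / (real N powr (real j * (\<mu> - \<zeta>) / \<mu>) * d_seq N \<mu> c j powr \<zeta>)) summable_on UNIV"
    using N_ge2 norm_const_pos by (intro summable_on_cmult_right') simp
  finally show ?thesis .
qed

text \<open>The factor \<open>norm_const * N powr (- j / \<mu>)\<close> is common to rate and tail
  and cancels in the quotient; the limsup is invariant under the index shift.\<close>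

lemma r_tail_condition_iff: "r_tail_condition rate \<longleftrightarrow> c_tail_condition N \<mu> c"
proof -
  have "1 / rate (Suc j) * (\<Sum>\<^sub>\<infinity>i\<in>{Suc j + 1..}. rate i) = 1 / c j * c_tail N \<mu> c j" for j
    using norm_const_pos N_ge2 by (simp add: rate_Suc rate_tail[simplified] weight_def)
  then have "limsup (\<lambda>j. ereal (1 / rate (j + 1) * (\<Sum>\<^sub>\<infinity>i\<in>{j + 1 + 1..}. rate i)))
      = limsup (\<lambda>j. ereal (1 / c j * c_tail N \<mu> c j))"
    by simp
  then show ?thesis
    unfolding r_tail_condition_def c_tail_condition_def
    using limsup_shift[of "\<lambda>j. ereal (1 / rate j * (\<Sum>\<^sub>\<infinity>i\<in>{j + 1..}. rate i))"] by simp
qed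

text \<open>Always \<open>c j \<le> d_seq N \<mu> c j\<close>, and the tail condition gives the
  reverse bound eventually, up to a constant. The two series are therefore comparable term by
  term.\<close>

lemma summable_on_d_seq_iff_c:
  assumes "c_tail_condition N \<mu> c" "\<zeta> > 0"
  shows "(\<lambda>j. 1 / (real N powr (real j * (\<mu> - \<zeta>) / \<mu>) * d_seq N \<mu> c j powr \<zeta>)) summable_on UNIV \<longleftrightarrow>
    (\<lambda>j. 1 / (real N powr (real j * (\<mu> - \<zeta>) / \<mu>) * c j powr \<zeta>)) summable_on UNIV"
proof -
  let ?n = "\<lambda>j. real N powr (real j * (\<mu> - \<zeta>) / \<mu>)"
  let ?f = "\<lambda>j. 1 / (?n j * d_seq N \<mu> c j powr \<zeta>)" and ?g = "\<lambda>j. 1 / (?n j * c j powr \<zeta>)"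
  obtain q where q: "\<forall>\<^sub>F j in sequentially. 1 / c j * c_tail N \<mu> c j < q"
    using assms(1) unfolding c_tail_condition_def by (rule limsup_ereal_less_imp_eventually)
  \<comment> \<open>The coefficient of \<open>c j\<close> in \<open>d_seq\<close> plus a bound for
    the relative tail; the absolute value makes positivity of \<open>K\<close> immediate.\<close>
  define K where "K = real N / (real N - 1) + \<bar>q\<bar>"
  have N: "real N > 1"
    using N_ge2 by simp
  then have "K > 0"
    by (simp add: K_def add_pos_nonneg)
  have c_le: "c j \<le> d_seq N \<mu> c j" for j
  proof -
    have "1 * c j \<le> real N / (real N - 1) * c j"
      using N c_pos[of j] by (intro mult_right_mono) auto
    then show ?thesis
      using c_tail_nonneg[of j] by (simp add: d_seq_def)
  qed
  have le_c: "\<forall>\<^sub>F j in sequentially. d_seq N \<mu> c j \<le> K * c j"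
    using q
  proof eventually_elim
    fix j assume "1 / c j * c_tail N \<mu> c j < q"
    then have "c_tail N \<mu> c j < q * c j"
      using c_pos[of j] by (simp add: field_simps)
    also have "\<dots> \<le> \<bar>q\<bar> * c j"
      using c_pos[of j] by (intro mult_right_mono) auto
    finally show "d_seq N \<mu> c j \<le> K * c j"
      by (simp add: d_seq_def K_def distrib_right)
  qed
  have f_le_g: "?f j \<le> 1 * ?g j" for j
    using N c_pos[of j] d_seq_pos[of j] powr_mono2[OF less_imp_le[OF assms(2)] _ c_le[of j]]
    by (simp add: frac_le)
  have g_le_f: "\<forall>\<^sub>F j in sequentially. ?g j \<le> K powr \<zeta> * ?f j"
    using le_c
  proof eventually_elim
    fix j assume "d_seq N \<mu> c j \<le> K * c j"
    then have "d_seq N \<mu> c j powr \<zeta> \<le> K powr \<zeta> * c j powr \<zeta>"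
      using powr_mono2[of \<zeta> "d_seq N \<mu> c j" "K * c j"] assms(2) d_seq_pos[of j] \<open>K > 0\<close> c_pos[of j]
      by (simp add: powr_mult less_imp_le)
    then show "?g j \<le> K powr \<zeta> * ?f j"
      using N c_pos[of j] d_seq_pos[of j] by (simp add: divide_simps mult_ac)
  qed
  have "summable ?f \<longleftrightarrow> summable ?g"
    using summable_nonneg_comparison[of ?f 1 ?g] summable_nonneg_comparison[of ?g "K powr \<zeta>" ?f]
      f_le_g g_le_f by auto
  then show ?thesis
    by (simp add: summable_on_UNIV_nonneg_real_iff)
qed

text \<open>From some index on, the weights grow at most like powers of some
  \<open>q < N powr (1 / \<mu>)\<close>. The tail at \<open>j\<close> is then at most
  \<open>c j\<close> times a convergent geometric series that does not depend on
  \<open>j\<close>.\<close>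

lemma c_tail_condition_ratio:
  assumes "limsup (\<lambda>j. ereal (c (j + 1) / c j)) < ereal (real N powr (1 / \<mu>))"
  shows "c_tail_condition N \<mu> c"
proof -
  define p where "p = real N powr (1 / \<mu>)"
  have p: "p > 0"
    using N_ge2 by (simp add: p_def)
  obtain q where q: "q < p" "\<forall>\<^sub>F j in sequentially. c (j + 1) / c j < q"
    using limsup_ereal_less_imp_eventually[OF assms] by (metis less_ereal.simps(1) p_def)
  then obtain J where J: "\<And>j. j \<ge> J \<Longrightarrow> c (j + 1) / c j < q"
    by (auto simp: eventually_sequentially)
  \<comment> \<open>Positivity of \<open>q\<close> is inherited from the ratios that it
    bounds.\<close>
  have "0 < c (J + 1) / c J"
    using c_pos by simp
  then have "q > 0"
    using J[of J] by linarith
  have step: "c (Suc j) \<le> q * c j" if "j \<ge> J" for j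
    using J[OF that] c_pos[of j] by (simp add: field_simps)
  have geometric: "c (j + n) \<le> q ^ n * c j" if "j \<ge> J" for j n
  proof (induction n)
    case (Suc n)
    have "c (j + Suc n) \<le> q * c (j + n)"
      using step[of "j + n"] that by simp
    also have "\<dots> \<le> q * (q ^ n * c j)"
      using Suc.IH \<open>q > 0\<close> by (intro mult_left_mono) auto
    finally show ?case
      by (simp add: mult_ac)
  qed simp
  have geometric_summable: "(\<lambda>n. (q / p) ^ Suc n) summable_on UNIV"
    using q(1) p \<open>q > 0\<close>
    by (intro norm_summable_imp_summable_on)
       (simp add: abs_mult power_abs summable_mult summable_geometric)
  define K where "K = (\<Sum>\<^sub>\<infinity>n. (q / p) ^ Suc n)"
  have "c_tail N \<mu> c j \<le> K * c j" if "j \<ge> J" for j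
  proof -
    let ?t = "\<lambda>i. c i / real N powr (real (i - j) / \<mu>)"
    have bij: "bij_betw (\<lambda>n. j + Suc n) UNIV {j+1..}"
      by (rule bij_betw_byWitness[where f' = "\<lambda>i. i - (j + 1)"]) auto
    have t: "?t (j + Suc n) = c (j + Suc n) / p ^ Suc n" for n
    proof -
      have "real N powr (real (Suc n) / \<mu>) = p powr real (Suc n)"
        by (simp add: p_def powr_powr)
      also have "\<dots> = p ^ Suc n"
        using p by (rule powr_realpow)
      finally show ?thesis
        by simp
    qed
    have t_le: "?t (j + Suc n) \<le> c j * (q / p) ^ Suc n" for n
      unfolding t using geometric[OF that, of "Suc n"] p
      by (simp add: power_divide divide_right_mono mult.commute)
    have summable: "(\<lambda>n. c j * (q / p) ^ Suc n) summable_on UNIV"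
      by (intro summable_on_cmult_right geometric_summable)
    have "c_tail N \<mu> c j = (\<Sum>\<^sub>\<infinity>n. ?t (j + Suc n))"
      unfolding c_tail_def by (rule infsum_reindex_bij_betw[OF bij, symmetric])
    also have "\<dots> \<le> (\<Sum>\<^sub>\<infinity>n. c j * (q / p) ^ Suc n)"
    proof (rule infsum_mono)
      show "(\<lambda>n. ?t (j + Suc n)) summable_on UNIV"
        using summable by (rule summable_on_comparison_test) (use t_le c_pos in \<open>auto simp: less_imp_le\<close>)
    qed (use summable t_le in auto)
    also have "\<dots> = K * c j"
      by (subst infsum_cmult_right') (simp only: K_def mult.commute)
    finally show ?thesis .
  qed
  then have "\<forall>\<^sub>F j in sequentially. 1 / c j * c_tail N \<mu> c j \<le> K"
    using c_pos by (auto simp: eventually_sequentially field_simps intro!: exI[of _ J])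
  then have "limsup (\<lambda>j. ereal (1 / c j * c_tail N \<mu> c j)) \<le> ereal K"
    by (rule limsup_ereal_le)
  then show ?thesis
    unfolding c_tail_condition_def by (rule order.strict_trans1) simp
qed

end

text \<open>Provides the summability condition for group orders where only the growth of the weights
  is known: the ratio test applies with ratio \<open>q / N powr (1 / \<mu>)\<close>.\<close>

lemma mu_weights_summable_ratio:
  assumes "N \<ge> 2" "\<And>j. c j > 0"
    and ratio: "\<forall>\<^sub>F j in sequentially. c (j + 1) / c j < q" "q < real N powr (1 / \<mu>)"
  shows "mu_weights_summable N \<mu> c"
proof -
  define p where "p = real N powr (1 / \<mu>)"
  have p: "p > 0"
    using assms(1) by (simp add: p_def)
  have weight: "(\<lambda>j. c j * real N powr (- real j / \<mu>)) = (\<lambda>j. c j / p ^ j)"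
  proof
    fix j
    have "real N powr (- real j / \<mu>) = p powr (- real j)"
      by (simp add: p_def powr_powr)
    then show "c j * real N powr (- real j / \<mu>) = c j / p ^ j"
      using p by (simp add: powr_minus powr_realpow divide_inverse)
  qed
  obtain J where J: "\<And>j. j \<ge> J \<Longrightarrow> c (j + 1) / c j < q"
    using ratio(1) by (auto simp: eventually_sequentially)
  have "summable (\<lambda>j. c j / p ^ j)"
  proof (rule summable_ratio_test[where c = "q / p" and N = J])
    show "q / p < 1"
      using ratio(2) p by (simp add: p_def)
    show "norm (c (Suc j) / p ^ Suc j) \<le> q / p * norm (c j / p ^ j)" if "j \<ge> J" for j
      using J[OF that] assms(2)[of j] assms(2)[of "Suc j"] p by (simp add: field_simps)
  qed
  then show ?thesis
    using assms(2) p unfolding mu_weights_summable_def weight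
    by (simp add: summable_on_UNIV_nonneg_real_iff less_imp_le)
qed

theorem proposition3p2p3:
  fixes N :: nat and \<mu> \<zeta> :: real and c :: "nat \<Rightarrow> real"
  assumes "N \<ge> 2" and "\<mu> > 0" and "\<zeta> > 0"
    and "\<And>j. c j > 0" and "mu_weights_summable N \<mu> c"
  defines "r \<equiv> mu_rates N \<mu> c"
  shows "(green_power_finite N r \<zeta> \<longleftrightarrow>
            (\<lambda>j. 1 / (real N ^ j * h_seq N r j powr \<zeta>)) summable_on {1..})
       \<and> (green_power_finite N r \<zeta> \<longleftrightarrow>
            (\<lambda>j. 1 / (real N powr (real j * (\<mu> - \<zeta>) / \<mu>) * d_seq N \<mu> c j powr \<zeta>))
              summable_on UNIV)
       \<and> (r_tail_condition r \<longleftrightarrow> c_tail_condition N \<mu> c)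
       \<and> (r_tail_condition r \<longrightarrow>
            (green_power_finite N r \<zeta> \<longleftrightarrow>
              (\<lambda>j. 1 / (real N powr (real j * (\<mu> - \<zeta>) / \<mu>) * c j powr \<zeta>)) summable_on UNIV))
       \<and> (limsup (\<lambda>j. ereal (c (j + 1) / c j)) < ereal (real N powr (1 / \<mu>)) \<longrightarrow>
            r_tail_condition r)
       \<and> (limsup (\<lambda>j. ereal (c (j + 1) / c j)) < \<infinity> \<longrightarrow>
            (\<forall>\<^sub>F N' in sequentially.
               mu_weights_summable N' \<mu> c \<and> r_tail_condition (mu_rates N' \<mu> c)))"
proof -
  interpret mu_walk N \<mu> c
    using assms(1,2,4,5) by unfold_locales
  have "\<forall>\<^sub>F N' in sequentially. mu_weights_summable N' \<mu> c \<and> r_tail_condition (mu_rates N' \<mu> c)"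
    if lim: "limsup (\<lambda>j. ereal (c (j + 1) / c j)) < \<infinity>"
  proof -
    obtain q where q: "\<forall>\<^sub>F j in sequentially. c (j + 1) / c j < q"
      using limsup_ereal_less_imp_eventually[OF lim] .
    \<comment> \<open>The bound \<open>q\<close> depends on the weights only, whereas
      \<open>N' powr (1 / \<mu>)\<close> tends to infinity since \<open>\<mu> > 0\<close>.\<close>
    have "\<forall>\<^sub>F N' in sequentially. q < real N' powr (1 / \<mu>)"
      using \<open>\<mu> > 0\<close> by (intro eventually_compose_filterlim[OF eventually_gt_at_top]
        filterlim_compose[OF real_powr_at_top filterlim_real_sequentially]) simp
    then show ?thesis
      using eventually_ge_at_top[of 2]
    proof eventually_elim
      fix N' :: nat
      assume N': "q < real N' powr (1 / \<mu>)" "N' \<ge> 2"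
      then interpret N': mu_walk N' \<mu> c
        using assms(2,4) q by unfold_locales (auto intro: mu_weights_summable_ratio)
      have "limsup (\<lambda>j. ereal (c (j + 1) / c j)) \<le> ereal q"
        using q by (intro limsup_ereal_le) (auto elim: eventually_mono)
      also have "\<dots> < ereal (real N' powr (1 / \<mu>))"
        using N' by simp
      finally show "mu_weights_summable N' \<mu> c \<and> r_tail_condition (mu_rates N' \<mu> c)"
        using N'.weights_summable N'.c_tail_condition_ratio N'.r_tail_condition_iff by blast
    qed
  qed
  then show ?thesis
    unfolding r_def
    using green_power_finite_iff[OF assms(3)] summable_on_h_seq_iff_d_seq r_tail_condition_iff
      summable_on_d_seq_iff_c[OF _ assms(3)] c_tail_condition_ratio
    by simp
qed

end
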